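(* Let $n\ge2$ and $2\le k\le n$, let $\mathbb H^n$ be the $n$-dimensional real hyperbolic space, and let $1\le q,p\le\infty$. If $q<\frac{n-1}{k-1}<p$, then $H^k_{q,p}(\mathbb H^n)\neq0$.
   Context: For an oriented $n$-dimensional Riemannian manifold $M$, $L^p(M,\Lambda^k)$ is the Banach space of (locally integrable) $k$-forms $\theta$ whose pointwise norm $|\theta|$ lies in $L^p(M)$ with respect to the Riemannian volume. For locally integrable forms $\phi$ (degree $k-1$) and $\theta$ (degree $k$), $d\phi=\theta$ in the weak sense means $\int_M\theta\wedge\omega=(-1)^k\int_M\phi\wedge d\omega$ for all smooth compactly supported $(n-k)$-forms $\omega$. Put $Z^k_p(M)=L^p(M,\Lambda^k)\cap\ker d$ and $B^k_{q,p}(M)=d(L^q(M,\Lambda^{k-1}))\cap L^p(M,\Lambda^k)$ (forms in $L^p$ that are weak differentials of a form in $L^q$). The $L_{q,p}$-cohomology is $H^k_{q,p}(M)=Z^k_p(M)/B^k_{q,p}(M)$, $1\le p,q\le\infty$. In polar coordinates, $\mathbb H^n$ has the metric $dr^2+\sinh(r)^2h$, with $h$ the standard metric on $\mathbb S^{n-1}$. *)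

theory Defs
  imports "HOL-Analysis.Analysis" "HOL-Combinatorics.Permutations"
begin

text \<open>
  All manifolds here are given by one global chart: the manifold is \<open>real ^ 'n\<close>, with a
  Riemannian metric \<open>g\<close> given by its matrix at every point.  This covers hyperbolic space, for
  which geodesic polar coordinates (equivalently, the exponential map at a point) are a
  diffeomorphism with \<open>real ^ 'n\<close>; the dimension \<open>n\<close> is \<open>CARD('n)\<close>.
\<close>

subsection \<open>Alternating forms and differential forms\<close>

text \<open>
  A covector of degree \<open>k\<close> takes a sequence of vectors, of which it only inspects those with
  index \<open>i < k\<close>.
\<close>

type_synonym 'n alt = "(nat \<Rightarrow> real ^ 'n) \<Rightarrow> real"
type_synonym 'n dform = "real ^ 'n \<Rightarrow> 'n alt"

definition alternating :: "nat \<Rightarrow> 'n::finite alt \<Rightarrow> bool" where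
  "alternating k \<alpha> \<longleftrightarrow>
     (\<forall>v w. (\<forall>i<k. v i = w i) \<longrightarrow> \<alpha> v = \<alpha> w) \<and>
     (\<forall>v. \<forall>i<k. linear (\<lambda>u. \<alpha> (v(i := u)))) \<and>
     (\<forall>v. \<forall>i<k. \<forall>j<k. i \<noteq> j \<and> v i = v j \<longrightarrow> \<alpha> v = 0)"

text \<open>Normalised so that \<open>(dx \<and> dy) (\<partial>\<^sub>x, \<partial>\<^sub>y) = 1\<close>.\<close>

definition wedge :: "nat \<Rightarrow> nat \<Rightarrow> 'n::finite alt \<Rightarrow> 'n alt \<Rightarrow> 'n alt" where
  "wedge k l \<alpha> \<beta> v =
     (\<Sum>\<sigma> | \<sigma> permutes {..<k + l}.
        of_int (sign \<sigma>) * \<alpha> (\<lambda>i. v (\<sigma> i)) * \<beta> (\<lambda>i. v (\<sigma> (k + i)))) / (fact k * fact l)"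

definition ext_deriv :: "nat \<Rightarrow> 'n::finite dform \<Rightarrow> 'n dform" where
  "ext_deriv k \<omega> x v =
     (\<Sum>i\<le>k. (-1) ^ i *
        frechet_derivative (\<lambda>y. \<omega> y (\<lambda>j. if j < i then v j else v (Suc j))) (at x) (v i))"

fun Ck :: "nat \<Rightarrow> (real ^ 'n::finite \<Rightarrow> real) \<Rightarrow> bool" where
  "Ck 0 f \<longleftrightarrow> continuous_on UNIV f"
| "Ck (Suc m) f \<longleftrightarrow>
     (\<forall>x. f differentiable at x) \<and> (\<forall>v. Ck m (\<lambda>x. frechet_derivative f (at x) v))"

definition smooth :: "(real ^ 'n::finite \<Rightarrow> real) \<Rightarrow> bool" where
  "smooth f \<longleftrightarrow> (\<forall>m. Ck m f)"

definition test_form :: "nat \<Rightarrow> 'n::finite dform \<Rightarrow> bool" where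
  "test_form k \<omega> \<longleftrightarrow>
     (\<forall>x. alternating k (\<omega> x)) \<and>
     (\<forall>v. smooth (\<lambda>x. \<omega> x v)) \<and>
     (\<exists>K. compact K \<and> (\<forall>x. x \<notin> K \<longrightarrow> \<omega> x = (\<lambda>v. 0)))"

text \<open>
  Local integrability is stated with Lebesgue measure of the chart, which is equivalent to using
  the Riemannian volume because the volume density of a Riemannian metric is continuous and
  positive.  Forms are represented by Borel measurable ones; forms that agree almost everywhere
  are identified in the cohomology below, since their difference is a weak differential of \<open>0\<close>.
\<close>

definition loc_integrable_form :: "nat \<Rightarrow> 'n::finite dform \<Rightarrow> bool" where
  "loc_integrable_form k \<theta> \<longleftrightarrow>
     (\<forall>x. alternating k (\<theta> x)) \<and>
     (\<forall>v K. compact K \<longrightarrow> set_integrable lborel K (\<lambda>x. \<theta> x v))"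

text \<open>
  The orientation is the one of the frame \<open>std_frame\<close>, i.e. of an arbitrary enumeration of the
  coordinates; reversing it changes the sign of both sides of the equation in \<open>weak_deriv\<close>.
\<close>

definition std_frame :: "nat \<Rightarrow> real ^ 'n::finite" where
  "std_frame i = axis (from_nat_into UNIV i) 1"

definition integral_form :: "'n::finite dform \<Rightarrow> real" where
  "integral_form \<omega> = (LINT x|lborel. \<omega> x std_frame)"

text \<open>
  \<open>weak_deriv k \<phi> \<theta>\<close>: the \<open>k+1\<close>-form \<open>\<theta>\<close> is the weak differential of the \<open>k\<close>-form \<open>\<phi>\<close>.
  If \<open>k = n\<close> there is no \<open>l\<close> below, so that every \<open>n\<close>-form is closed.
\<close>

definition weak_deriv :: "nat \<Rightarrow> 'n::finite dform \<Rightarrow> 'n dform \<Rightarrow> bool" where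
  "weak_deriv k \<phi> \<theta> \<longleftrightarrow>
     (\<forall>l \<omega>. Suc k + l = CARD('n) \<and> test_form l \<omega> \<longrightarrow>
        integral_form (\<lambda>x. wedge (Suc k) l (\<theta> x) (\<omega> x)) =
        (-1) ^ Suc k * integral_form (\<lambda>x. wedge k (Suc l) (\<phi> x) (ext_deriv l \<omega> x)))"

subsection \<open>Riemannian metrics and \<open>L\<^sup>p\<close>-forms\<close>

text \<open>
  The norm induced by a scalar product with Gram matrix \<open>G\<close>, in index notation:
  \<open>|\<alpha>|\<^sup>2 = (1 / k!) G^(i_1 j_1) \<dots> G^(i_k j_k) \<alpha>(i_1, \<dots>, i_k) \<alpha>(j_1, \<dots>, j_k)\<close>,
  with upper indices for the inverse matrix.  Equivalently, \<open>|\<alpha>|\<^sup>2\<close> is the sum of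
  \<open>\<alpha>(b_(i_1), \<dots>, b_(i_k))\<^sup>2\<close> over \<open>i_1 < \<dots> < i_k\<close>, for any orthonormal basis \<open>b\<close>.
\<close>

definition alt_norm :: "real ^ 'n ^ 'n \<Rightarrow> nat \<Rightarrow> 'n::finite alt \<Rightarrow> real" where
  "alt_norm G k \<alpha> =
     sqrt ((\<Sum>I \<in> {..<k} \<rightarrow>\<^sub>E UNIV. \<Sum>J \<in> {..<k} \<rightarrow>\<^sub>E UNIV.
        (\<Prod>a<k. matrix_inv G $ I a $ J a) *
        \<alpha> (\<lambda>a. axis (I a) 1) * \<alpha> (\<lambda>a. axis (J a) 1)) / fact k)"

definition riem_volume :: "(real ^ 'n \<Rightarrow> real ^ 'n ^ 'n) \<Rightarrow> (real ^ 'n::finite) measure" where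
  "riem_volume g = density lborel (\<lambda>x. ennreal (sqrt (det (g x))))"

definition in_Lp :: "'a measure \<Rightarrow> ereal \<Rightarrow> ('a \<Rightarrow> real) \<Rightarrow> bool" where
  "in_Lp M p f \<longleftrightarrow> f \<in> borel_measurable M \<and>
     (if p = \<infinity> then \<exists>C. AE x in M. \<bar>f x\<bar> \<le> C
      else integrable M (\<lambda>x. \<bar>f x\<bar> powr real_of_ereal p))"

definition Lp_forms ::
  "(real ^ 'n \<Rightarrow> real ^ 'n ^ 'n) \<Rightarrow> ereal \<Rightarrow> nat \<Rightarrow> 'n::finite dform set" where
  "Lp_forms g p k =
     {\<theta>. loc_integrable_form k \<theta> \<and> in_Lp (riem_volume g) p (\<lambda>x. alt_norm (g x) k (\<theta> x))}"

subsection \<open>\<open>L\<^bsub>q,p\<^esub>\<close>-cohomology\<close>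

definition Z_forms ::
  "(real ^ 'n \<Rightarrow> real ^ 'n ^ 'n) \<Rightarrow> nat \<Rightarrow> ereal \<Rightarrow> 'n::finite dform set" where
  "Z_forms g k p = {\<theta> \<in> Lp_forms g p k. weak_deriv k \<theta> (\<lambda>x v. 0)}"

text \<open>For \<open>k = 0\<close> the only form of degree \<open>k - 1\<close> is \<open>0\<close>.\<close>

definition B_forms ::
  "(real ^ 'n \<Rightarrow> real ^ 'n ^ 'n) \<Rightarrow> nat \<Rightarrow> ereal \<Rightarrow> ereal \<Rightarrow> 'n::finite dform set" where
  "B_forms g k q p = {\<theta> \<in> Lp_forms g p k.
     (case k of
        0 \<Rightarrow> AE x in lborel. \<theta> x = (\<lambda>v. 0)
      | Suc j \<Rightarrow> \<exists>\<phi> \<in> Lp_forms g q j. weak_deriv j \<phi> \<theta>)}"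

definition cohom_rel ::
  "(real ^ 'n \<Rightarrow> real ^ 'n ^ 'n) \<Rightarrow> nat \<Rightarrow> ereal \<Rightarrow> ereal \<Rightarrow> ('n::finite dform \<times> 'n dform) set" where
  "cohom_rel g k q p =
     {(\<theta>, \<theta>'). \<theta> \<in> Z_forms g k p \<and> \<theta>' \<in> Z_forms g k p \<and>
        (\<lambda>x v. \<theta> x v - \<theta>' x v) \<in> B_forms g k q p}"

definition Lqp_cohomology ::
  "(real ^ 'n \<Rightarrow> real ^ 'n ^ 'n) \<Rightarrow> nat \<Rightarrow> ereal \<Rightarrow> ereal \<Rightarrow> 'n::finite dform set set" where
  "Lqp_cohomology g k q p = Z_forms g k p // cohom_rel g k q p"

definition cohom_zero ::
  "(real ^ 'n \<Rightarrow> real ^ 'n ^ 'n) \<Rightarrow> nat \<Rightarrow> ereal \<Rightarrow> ereal \<Rightarrow> 'n::finite dform set" where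
  "cohom_zero g k q p = cohom_rel g k q p `` {\<lambda>x v. 0}"

subsection \<open>Hyperbolic space\<close>

text \<open>
  With \<open>r = norm x\<close> one has \<open>dr = \<Sum> x\<^sub>i dx\<^sub>i / r\<close>, and the Euclidean metric is \<open>dr\<^sup>2 + r\<^sup>2 h\<close>, so that
  \<open>dr\<^sup>2 + sinh(r)\<^sup>2 h = dr\<^sup>2 + (sinh(r) / r)\<^sup>2 (\<Sum> dx\<^sub>i\<^sup>2 - dr\<^sup>2)\<close>, which extends smoothly by the Euclidean
  metric at the pole \<open>x = 0\<close>.
\<close>

definition hyperbolic_metric :: "real ^ 'n \<Rightarrow> real ^ 'n ^ 'n::finite" where
  "hyperbolic_metric x = (\<chi> i j.
     let \<delta> = (if i = j then 1 else 0); \<rho> = x $ i * x $ j / (norm x)\<^sup>2 in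
     if x = 0 then \<delta> else \<rho> + (sinh (norm x) / norm x)\<^sup>2 * (\<delta> - \<rho>))"

text \<open>
  The vector below is the image of \<open>(a, w)\<close>, with \<open>w\<close> tangent to the unit sphere at \<open>u\<close>, under the
  derivative of \<open>(r, u) \<mapsto> r u\<close>.
\<close>

lemma hyperbolic_metric_polar:
  fixes u w :: "real ^ 'n::finite" and r a :: real
  assumes "r > 0" "norm u = 1" "u \<bullet> w = 0"
  defines "V \<equiv> a *\<^sub>R u + r *\<^sub>R w"
  shows "V \<bullet> (hyperbolic_metric (r *\<^sub>R u) *v V) = a\<^sup>2 + (sinh r)\<^sup>2 * (norm w)\<^sup>2"
proof -
  define c where "c = (sinh r / r)\<^sup>2"
  have [simp]: "norm (r *\<^sub>R u) = r" "r *\<^sub>R u \<noteq> 0" "u \<noteq> 0"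
    using assms(1,2) by auto
  have ent: "hyperbolic_metric (r *\<^sub>R u) $ i $ j =
      u $ i * u $ j + c * ((if i = j then 1 else 0) - u $ i * u $ j)" for i j
    using assms(1,2) by (simp add: hyperbolic_metric_def Let_def c_def power2_eq_square)
  have uV: "u \<bullet> V = a"
    using assms by (simp add: V_def inner_add_right flip: power2_norm_eq_inner)
  have "V \<bullet> V = a\<^sup>2 * (u \<bullet> u) + 2 * a * r * (u \<bullet> w) + r\<^sup>2 * (w \<bullet> w)"
    unfolding V_def inner_add_left inner_add_right inner_scaleR_left inner_scaleR_right
    by (simp only: inner_commute[of w u]) (simp add: algebra_simps power2_eq_square)
  then have VV: "V \<bullet> V = a\<^sup>2 + r\<^sup>2 * (norm w)\<^sup>2"
    using assms(2,3) by (simp add: dot_square_norm)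
  have "hyperbolic_metric (r *\<^sub>R u) *v V = c *\<^sub>R V + ((1 - c) * (u \<bullet> V)) *\<^sub>R u"
  proof (rule vec_eq_iff[THEN iffD2], rule allI)
    fix i
    have "(hyperbolic_metric (r *\<^sub>R u) *v V) $ i =
        (\<Sum>j\<in>UNIV. c * (if i = j then V $ j else 0) + (1 - c) * u $ i * (u $ j * V $ j))"
      unfolding matrix_vector_mult_def by (auto simp: ent algebra_simps intro!: sum.cong)
    also have "\<dots> = c * V $ i + (1 - c) * u $ i * (u \<bullet> V)"
      by (simp add: sum.distrib inner_vec_def flip: sum_distrib_left)
    finally show "(hyperbolic_metric (r *\<^sub>R u) *v V) $ i =
        (c *\<^sub>R V + ((1 - c) * (u \<bullet> V)) *\<^sub>R u) $ i" by simp
  qed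
  then have "V \<bullet> (hyperbolic_metric (r *\<^sub>R u) *v V) = c * (V \<bullet> V) + (1 - c) * a * a"
    using uV by (simp add: inner_add_right inner_commute[of V u])
  also have "\<dots> = a\<^sup>2 + (c * r\<^sup>2) * (norm w)\<^sup>2"
    by (simp add: VV algebra_simps power2_eq_square)
  also have "c * r\<^sup>2 = (sinh r)\<^sup>2"
    using assms(1) by (simp add: c_def power_divide)
  finally show ?thesis .
qed

end

theory Submission
  imports Defs "HOL-Computational_Algebra.Polynomial"
begin

text \<open>
  In the chart the form \<open>\<theta> = dx\<^sub>1 \<and> \<dots> \<and> dx\<^sub>k\<close> is constant, hence closed.  With \<open>w = sinh r / r\<close>, at least
  \<open>k - 1\<close> of its \<open>k\<close> factors are tangential to the spheres around the pole, so that
  \<open>|\<theta>| \<le> C w\<^bsup>-(k - 1)\<^esup>\<close>; since the volume density is \<open>w\<^bsup>n - 1\<^esup>\<close>, this is in \<open>L\<^sup>p\<close> for \<open>p (k - 1) > n - 1\<close>.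

  Suppose that \<open>- \<theta> = d\<phi>\<close> with \<open>\<phi>\<close> in \<open>L\<^sup>q\<close>, and test this with \<open>\<omega> = \<eta>(x / R) dx\<^sub>k\<^sub>+\<^sub>1 \<and> \<dots> \<and> dx\<^sub>n\<close> for a radial
  bump function \<open>\<eta>\<close>.  As \<open>d\<omega>\<close> contains the factor \<open>dr\<close>, only tangential components of \<open>\<phi>\<close> enter, and
  the right-hand side is at most \<open>(C / R) \<integral> |\<phi>| w\<^bsup>k - 1\<^esup> dx\<close>.  The integral is finite because
  \<open>q (k - 1) < n - 1\<close>, whereas \<open>\<integral> \<theta> \<and> \<omega> = \<integral> \<eta>(x / R) dx\<close> stays away from \<open>0\<close> as \<open>R \<rightarrow> \<infinity>\<close>.
\<close>

subsection \<open>Multilinear and alternating forms\<close>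

text \<open>A primitive \<phi> is only locally integrable, so its restriction to a sphere need not
  make sense; the pairing with test forms whose differential is radial takes the place of Stokes on
  large balls. The threshold (n-1)/(k-1) is a balance of powers of w: each tangential argument
  accounts for one factor w, the volume density for n - 1 of them. After this bookkeeping both
  estimates reduce to the integral of w^(-e) over the chart, with e = p(k-1) - (n-1) for \<theta>
  and e = ((n-1) - q(k-1))/(q-1) for \<phi> when q > 1. Every e > 0 will do, because w grows
  exponentially in r while Euclidean balls grow polynomially. The factor 1/R arises because the
  differential of the bump has size |x|/R^2 and is supported in |x| \<le> R. Constants may be crude
  as long as they do not depend on R.\<close>

definition multilinear_form :: "nat \<Rightarrow> 'n::finite alt \<Rightarrow> bool" where
  "multilinear_form k \<alpha> \<longleftrightarrow>
     (\<forall>v w. (\<forall>i<k. v i = w i) \<longrightarrow> \<alpha> v = \<alpha> w) \<and>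
     (\<forall>v. \<forall>i<k. linear (\<lambda>u. \<alpha> (v(i := u))))"

lemma alternating_iff:
  "alternating k \<alpha> \<longleftrightarrow>
     multilinear_form k \<alpha> \<and> (\<forall>v. \<forall>i<k. \<forall>j<k. i \<noteq> j \<and> v i = v j \<longrightarrow> \<alpha> v = 0)"
  by (auto simp: alternating_def multilinear_form_def)

lemma alternating_multilinear: "alternating k \<alpha> \<Longrightarrow> multilinear_form k \<alpha>"
  by (simp add: alternating_iff)

lemma multilinear_form_cong:
  assumes "multilinear_form k \<alpha>" "\<And>i. i < k \<Longrightarrow> v i = w i"
  shows "\<alpha> v = \<alpha> w"
  using assms unfolding multilinear_form_def by blast

lemma multilinear_form_linear:
  "multilinear_form k \<alpha> \<Longrightarrow> i < k \<Longrightarrow> linear (\<lambda>u. \<alpha> (v(i := u)))"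
  by (simp add: multilinear_form_def)

lemma alternating_repeated:
  "alternating k \<alpha> \<Longrightarrow> i < k \<Longrightarrow> j < k \<Longrightarrow> i \<noteq> j \<Longrightarrow> v i = v j \<Longrightarrow> \<alpha> v = 0"
  unfolding alternating_def by blast

lemma multilinear_form_compose:
  fixes S :: "real ^ 'n::finite \<Rightarrow> real ^ 'n"
  assumes "multilinear_form k \<alpha>" "linear S"
  shows "multilinear_form k (\<lambda>v. \<alpha> (\<lambda>i. S (v i)))"
  unfolding multilinear_form_def
proof (intro conjI allI impI)
  fix v w :: "nat \<Rightarrow> real ^ 'n" assume "\<forall>i<k. v i = w i"
  then show "\<alpha> (\<lambda>i. S (v i)) = \<alpha> (\<lambda>i. S (w i))"
    using assms(1) by (intro multilinear_form_cong) auto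
next
  fix v :: "nat \<Rightarrow> real ^ 'n" and i assume "i < k"
  have "linear ((\<lambda>u. \<alpha> ((\<lambda>i. S (v i))(i := u))) \<circ> S)"
    using assms \<open>i < k\<close> by (intro linear_compose multilinear_form_linear)
  moreover have "(\<lambda>i. S (v i))(i := S u) = (\<lambda>j. S ((v(i := u)) j))" for u
    by auto
  ultimately show "linear (\<lambda>u. \<alpha> (\<lambda>j. S ((v(i := u)) j)))"
    by (simp add: o_def)
qed

lemma sum_PiE_lessThan_Suc:
  fixes f :: "(nat \<Rightarrow> 'a::finite) \<Rightarrow> real"
  shows "(\<Sum>I \<in> {..<Suc m} \<rightarrow>\<^sub>E UNIV. f I) = (\<Sum>I \<in> {..<m} \<rightarrow>\<^sub>E UNIV. \<Sum>i\<in>UNIV. f (I(m := i)))"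
proof -
  have "(\<Sum>I \<in> {..<Suc m} \<rightarrow>\<^sub>E UNIV. f I)
      = (\<Sum>p \<in> UNIV \<times> ({..<m} \<rightarrow>\<^sub>E UNIV). f ((snd p)(m := fst p)))"
    unfolding lessThan_Suc PiE_insert_eq
    by (subst sum.reindex[OF inj_combinator]) (auto simp: case_prod_beta)
  also have "\<dots> = (\<Sum>i\<in>UNIV. \<Sum>I \<in> {..<m} \<rightarrow>\<^sub>E UNIV. f (I(m := i)))"
    by (simp add: sum.cartesian_product case_prod_beta)
  also have "\<dots> = (\<Sum>I \<in> {..<m} \<rightarrow>\<^sub>E UNIV. \<Sum>i\<in>UNIV. f (I(m := i)))"
    by (rule sum.swap)
  finally show ?thesis .
qed

lemma multilinear_form_expand:
  fixes \<alpha> :: "'n::finite alt"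
  assumes "multilinear_form k \<alpha>"
  shows "\<alpha> v = (\<Sum>I \<in> {..<k} \<rightarrow>\<^sub>E UNIV. (\<Prod>a<k. v a $ I a) * \<alpha> (\<lambda>a. axis (I a) 1))"
proof -
  \<comment> \<open>Interpolates between the two sides: the first m slots hold basis vectors
    already, the others still hold the original arguments.\<close>
  define X where "X m I = (\<lambda>a. if a < m then axis (I a) 1 else v a)" for m and I :: "nat \<Rightarrow> 'n"
  have "\<alpha> v = (\<Sum>I \<in> {..<m} \<rightarrow>\<^sub>E UNIV. (\<Prod>a<m. v a $ I a) * \<alpha> (X m I))" if "m \<le> k" for m
    using that
  proof (induction m)
    case 0
    then show ?case by (simp add: X_def)
  next
    case (Suc m)
    have step: "\<alpha> (X m I) = (\<Sum>i\<in>UNIV. v m $ i * \<alpha> (X (Suc m) (I(m := i))))" for I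
    proof -
      have lin: "linear (\<lambda>u. \<alpha> ((X m I)(m := u)))"
        using Suc assms by (intro multilinear_form_linear) auto
      have "\<alpha> (X m I) = \<alpha> ((X m I)(m := (\<Sum>i\<in>UNIV. v m $ i *\<^sub>R axis i 1)))"
        by (rule arg_cong[of _ _ \<alpha>])
           (use basis_expansion[of "v m"] in \<open>auto simp: X_def fun_eq_iff scalar_mult_eq_scaleR\<close>)
      also have "\<dots> = (\<Sum>i\<in>UNIV. v m $ i * \<alpha> ((X m I)(m := axis i 1)))"
        using linear_sum[OF lin, of "\<lambda>i. v m $ i *\<^sub>R axis i 1" UNIV] linear_cmul[OF lin]
        by (simp only: real_scaleR_def)
      also have "(\<lambda>i. (X m I)(m := axis i 1)) = (\<lambda>i. X (Suc m) (I(m := i)))"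
        by (auto simp: X_def fun_eq_iff)
      then have "(\<Sum>i\<in>UNIV. v m $ i * \<alpha> ((X m I)(m := axis i 1)))
          = (\<Sum>i\<in>UNIV. v m $ i * \<alpha> (X (Suc m) (I(m := i))))"
        by (intro sum.cong refl) (metis (no_types))
      finally show ?thesis .
    qed
    have "\<alpha> v = (\<Sum>I \<in> {..<m} \<rightarrow>\<^sub>E UNIV. (\<Prod>a<m. v a $ I a) * \<alpha> (X m I))"
      using Suc by simp
    also have "\<dots> = (\<Sum>I \<in> {..<m} \<rightarrow>\<^sub>E UNIV. \<Sum>i\<in>UNIV.
        (\<Prod>a<Suc m. v a $ (I(m := i)) a) * \<alpha> (X (Suc m) (I(m := i))))"
      by (simp add: step sum_distrib_left mult.assoc)
    finally show ?case
      by (simp add: sum_PiE_lessThan_Suc)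
  qed
  from this[of k] have "\<alpha> v = (\<Sum>I \<in> {..<k} \<rightarrow>\<^sub>E UNIV. (\<Prod>a<k. v a $ I a) * \<alpha> (X k I))"
    by simp
  \<comment> \<open>Beyond k the index map is \<open>undefined\<close> and \<open>X k I\<close>
    still contains \<open>v\<close>; the two sequences agree only below k, which is all that
    \<alpha> inspects.\<close>
  also have "(\<lambda>I. \<alpha> (X k I)) = (\<lambda>I. \<alpha> (\<lambda>a. axis (I a) 1))"
    using assms by (intro ext multilinear_form_cong) (auto simp: X_def)
  then have "(\<Sum>I \<in> {..<k} \<rightarrow>\<^sub>E UNIV. (\<Prod>a<k. v a $ I a) * \<alpha> (X k I))
      = (\<Sum>I \<in> {..<k} \<rightarrow>\<^sub>E UNIV. (\<Prod>a<k. v a $ I a) * \<alpha> (\<lambda>a. axis (I a) 1))"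
    by metis
  finally show ?thesis .
qed

text \<open>Expanding all slots, every term with u in two of them vanishes, so only the terms of
  order zero and one in u survive. With u radial and t tangential this separates the two kinds of
  directions.\<close>

lemma alternating_shift:
  fixes \<alpha> :: "'n::finite alt"
  assumes alt: "alternating k \<alpha>"
  shows "\<alpha> (\<lambda>i. c i *\<^sub>R u + t i) = \<alpha> t + (\<Sum>a<k. c a * \<alpha> (t(a := u)))"
proof -
  define X where "X m t = (\<lambda>i. if i < m then c i *\<^sub>R u + t i else t i)" for m and t :: "nat \<Rightarrow> real ^ 'n"
  have "\<alpha> (X m t) = \<alpha> t + (\<Sum>a<m. c a * \<alpha> (t(a := u)))" if "m \<le> k" for m t
    using that
  proof (induction m arbitrary: t)
    case 0
    then show ?case by (simp add: X_def)
  next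
    case (Suc m)
    have lin: "linear (\<lambda>y. \<alpha> ((X m t)(m := y)))"
      using Suc alt by (intro multilinear_form_linear alternating_multilinear) auto
    have "X (Suc m) t = (X m t)(m := c m *\<^sub>R u + t m)"
      by (auto simp: X_def fun_eq_iff)
    then have "\<alpha> (X (Suc m) t) = c m * \<alpha> ((X m t)(m := u)) + \<alpha> ((X m t)(m := t m))"
      using linear_add[OF lin] linear_cmul[OF lin] by (simp only: real_scaleR_def)
    also have "(X m t)(m := t m) = X m t"
      by (auto simp: X_def fun_eq_iff)
    also have "(X m t)(m := u) = X m (t(m := u))"
      by (auto simp: X_def fun_eq_iff)
    \<comment> \<open>Slot m holds u already, so each first-order correction contains u twice. This
      instance at \<open>t(m := u)\<close> is why the induction keeps t arbitrary.\<close>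
    also have "\<alpha> (X m (t(m := u))) = \<alpha> (t(m := u))"
    proof -
      have "\<alpha> ((t(m := u))(a := u)) = 0" if "a < m" for a
        using Suc.prems that by (intro alternating_repeated[OF alt, of a m]) auto
      then have "(\<Sum>a<m. c a * \<alpha> (t(m := u, a := u))) = 0"
        by (intro sum.neutral) (simp del: fun_upd_apply)
      then show ?thesis
        using Suc.IH[of "t(m := u)"] Suc.prems by linarith
    qed
    finally show ?case
      using Suc.IH[of t] Suc.prems by (simp del: fun_upd_apply)
  qed
  from this[of k t] have "\<alpha> (X k t) = \<alpha> t + (\<Sum>a<k. c a * \<alpha> (t(a := u)))"
    by simp
  moreover have "\<alpha> (X k t) = \<alpha> (\<lambda>i. c i *\<^sub>R u + t i)"
    using alt by (intro multilinear_form_cong alternating_multilinear) (auto simp: X_def)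
  ultimately show ?thesis by simp
qed

lemma alternating_transpose:
  assumes alt: "alternating k \<alpha>" and ij: "i < k" "j < k" "i \<noteq> j"
  shows "\<alpha> (v \<circ> Transposition.transpose i j) = - \<alpha> v"
proof -
  note ml = alternating_multilinear[OF alt]
  have lin: "linear (\<lambda>u. \<alpha> (w(i := u)))" "linear (\<lambda>u. \<alpha> (w(j := u)))" for w
    using ml ij by (auto intro: multilinear_form_linear)
  have zero: "\<alpha> (v(i := x, j := x)) = 0" for x
    using ij by (intro alternating_repeated[OF alt, of i j]) auto
  have add_i: "\<alpha> (v(i := v i + v j, j := x)) = \<alpha> (v(i := v i, j := x)) + \<alpha> (v(i := v j, j := x))" for x
    using linear_add[OF lin(1), of "v(j := x)"] ij by (simp add: fun_upd_twist)
  have "0 = \<alpha> (v(i := v i + v j, j := v i + v j))"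
    by (simp only: zero)
  also have "\<dots> = \<alpha> (v(i := v i + v j, j := v i)) + \<alpha> (v(i := v i + v j, j := v j))"
    using linear_add[OF lin(2)] by blast
  also have "\<dots> = \<alpha> (v(i := v j, j := v i)) + \<alpha> (v(i := v i, j := v j))"
    by (simp only: add_i zero)
  finally have "\<alpha> (v(i := v j, j := v i)) = - \<alpha> v"
    by simp
  moreover have "v(i := v j, j := v i) = v \<circ> Transposition.transpose i j"
    using ij by (auto simp: fun_eq_iff Transposition.transpose_def)
  ultimately show ?thesis by simp
qed

lemma alternating_permutes:
  assumes alt: "alternating k \<alpha>" and "\<sigma> permutes {..<k}"
  shows "\<alpha> (v \<circ> \<sigma>) = of_int (sign \<sigma>) * \<alpha> v"
proof -
  have "finite {..<k}" by simp
  then show ?thesis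
    using assms(2)
  proof (induction rule: permutes_rev_induct)
    case id
    then show ?case by simp
  next
    case (swap a b p)
    have "sign (p \<circ> Transposition.transpose a b) = - sign p"
      using swap by (subst sign_compose)
        (auto simp: permutation_swap_id sign_swap_id intro: permutation_permutes[THEN iffD2])
    then show ?case
      using swap alternating_transpose[OF alt, of a b "v \<circ> p"]
      by (simp only: o_assoc lessThan_iff of_int_minus mult_minus_left simp_thms not_False_eq_True True_implies_equals)
  qed
qed

text \<open>Linearity in slot j is linearity of T in slot \<open>inv \<sigma> j\<close>. If v i = v
  j, composing \<sigma> with the transposition of i and j keeps the value of T and flips the sign,
  so the sum equals its own negative.\<close>

lemma alternating_alternation:
  fixes T :: "'n::finite alt"
  assumes "multilinear_form n T"
  shows "alternating n (\<lambda>v. \<Sum>\<sigma> | \<sigma> permutes {..<n}. of_int (sign \<sigma>) * T (\<lambda>i. v (\<sigma> i)))"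
  unfolding alternating_iff multilinear_form_def
proof (intro conjI allI impI)
  fix v w :: "nat \<Rightarrow> real ^ 'n" assume "\<forall>i<n. v i = w i"
  then have "T (\<lambda>i. v (\<sigma> i)) = T (\<lambda>i. w (\<sigma> i))" if "\<sigma> permutes {..<n}" for \<sigma>
    using that permutes_in_image[OF that] by (intro multilinear_form_cong[OF assms]) auto
  then show "(\<Sum>\<sigma> | \<sigma> permutes {..<n}. of_int (sign \<sigma>) * T (\<lambda>i. v (\<sigma> i))) =
      (\<Sum>\<sigma> | \<sigma> permutes {..<n}. of_int (sign \<sigma>) * T (\<lambda>i. w (\<sigma> i)))"
    by (intro sum.cong) auto
next
  fix v :: "nat \<Rightarrow> real ^ 'n" and j assume "j < n"
  have "linear (\<lambda>u. T (\<lambda>i. (v(j := u)) (\<sigma> i)))" if "\<sigma> permutes {..<n}" for \<sigma>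
  proof -
    have "(\<lambda>i. (v(j := u)) (\<sigma> i)) = (\<lambda>i. v (\<sigma> i))(inv \<sigma> j := u)" for u
      using permutes_inverses[OF that] by (auto simp: fun_eq_iff)
    moreover have "inv \<sigma> j < n"
      using permutes_in_image[OF permutes_inv[OF that], of j] \<open>j < n\<close> by auto
    ultimately show ?thesis
      using multilinear_form_linear[OF assms, of "inv \<sigma> j" "\<lambda>i. v (\<sigma> i)"] by (simp only:)
  qed
  then have "linear (\<lambda>u. of_int (sign \<sigma>) * T (\<lambda>i. (v(j := u)) (\<sigma> i)))"
    if "\<sigma> \<in> {\<sigma>. \<sigma> permutes {..<n}}" for \<sigma>
    using that linear_compose_scale_right[of "\<lambda>u. T (\<lambda>i. (v(j := u)) (\<sigma> i))" "of_int (sign \<sigma>)"]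
    by simp
  then show "linear (\<lambda>u. \<Sum>\<sigma> | \<sigma> permutes {..<n}. of_int (sign \<sigma>) * T (\<lambda>i. (v(j := u)) (\<sigma> i)))"
    by (intro linear_compose_sum) auto
next
  fix v :: "nat \<Rightarrow> real ^ 'n" and i j assume "i < n" "j < n" and ij: "i \<noteq> j \<and> v i = v j"
  let ?t = "Transposition.transpose i j"
  let ?g = "\<lambda>\<sigma>. of_int (sign \<sigma>) * T (\<lambda>i. v (\<sigma> i))"
  have t: "?t permutes {..<n}"
    using \<open>i < n\<close> \<open>j < n\<close> by (intro permutes_swap_id) auto
  have "?g (?t \<circ> \<sigma>) = - ?g \<sigma>" if "\<sigma> permutes {..<n}" for \<sigma>
  proof -
    have "sign (?t \<circ> \<sigma>) = - sign \<sigma>"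
      using that ij by (subst sign_compose)
        (auto simp: permutation_swap_id sign_swap_id intro: permutation_permutes[THEN iffD2])
    moreover have "(\<lambda>i. v ((?t \<circ> \<sigma>) i)) = (\<lambda>i. v (\<sigma> i))"
      using ij by (auto simp: fun_eq_iff Transposition.transpose_def)
    ultimately show ?thesis by simp
  qed
  then have "sum ?g {\<sigma>. \<sigma> permutes {..<n}} = - sum ?g {\<sigma>. \<sigma> permutes {..<n}}"
    by (subst setum_permutations_compose_left[OF t]) (simp add: sum_negf)
  then show "sum ?g {\<sigma>. \<sigma> permutes {..<n}} = 0"
    by simp
qed

text \<open>The tensor product whose alternation, up to the factorials, is
  \<open>wedge\<close>.\<close>

lemma multilinear_form_product:
  fixes \<alpha> \<beta> :: "'n::finite alt"
  assumes \<alpha>: "multilinear_form k \<alpha>" and \<beta>: "multilinear_form l \<beta>"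
  shows "multilinear_form (k + l) (\<lambda>v. \<alpha> v * \<beta> (\<lambda>i. v (k + i)))"
  unfolding multilinear_form_def
proof (intro conjI allI impI)
  fix v w :: "nat \<Rightarrow> real ^ 'n" assume "\<forall>i<k + l. v i = w i"
  then show "\<alpha> v * \<beta> (\<lambda>i. v (k + i)) = \<alpha> w * \<beta> (\<lambda>i. w (k + i))"
    using multilinear_form_cong[OF \<alpha>, of v w]
      multilinear_form_cong[OF \<beta>, of "\<lambda>i. v (k + i)" "\<lambda>i. w (k + i)"] by auto
next
  fix v :: "nat \<Rightarrow> real ^ 'n" and i assume "i < k + l"
  show "linear (\<lambda>u. \<alpha> (v(i := u)) * \<beta> (\<lambda>j. (v(i := u)) (k + j)))"
  proof (cases "i < k")
    case True
    then have "(\<lambda>j. (v(i := u)) (k + j)) = (\<lambda>j. v (k + j))" for u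
      by auto
    moreover have "linear (\<lambda>u. \<beta> (\<lambda>j. v (k + j)) *\<^sub>R \<alpha> (v(i := u)))"
      by (intro linear_compose_scale_right multilinear_form_linear[OF \<alpha> True])
    ultimately show ?thesis by (simp add: mult.commute)
  next
    case False
    have "(\<lambda>j. (v(i := u)) (k + j)) = (\<lambda>j. v (k + j))(i - k := u)" for u
      using False by (auto simp: fun_eq_iff)
    moreover have "\<alpha> (v(i := u)) = \<alpha> v" for u
      using False by (intro multilinear_form_cong[OF \<alpha>]) auto
    moreover have "linear (\<lambda>u. \<alpha> v *\<^sub>R \<beta> ((\<lambda>j. v (k + j))(i - k := u)))"
      using False \<open>i < k + l\<close>
      by (intro linear_compose_scale_right multilinear_form_linear[OF \<beta>]) auto
    ultimately show ?thesis by simp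
  qed
qed

lemma alternating_scale:
  assumes "alternating k \<alpha>"
  shows "alternating k (\<lambda>v. c * \<alpha> v)"
proof -
  have "linear (\<lambda>u. c *\<^sub>R \<alpha> (v(i := u)))" if "i < k" for v i
    using assms that by (intro linear_compose_scale_right multilinear_form_linear alternating_multilinear)
  then show ?thesis
    using assms unfolding alternating_def real_scaleR_def
    by (intro conjI allI impI) (metis, blast, simp)
qed

text \<open>Multilinear factors suffice because the sum over permutations antisymmetrises. This
  matters for \<open>covector_wedge\<close>, which enters below only as a multilinear form.\<close>

lemma alternating_wedge:
  fixes \<alpha> \<beta> :: "'n::finite alt"
  assumes "multilinear_form k \<alpha>" and "multilinear_form l \<beta>"
  shows "alternating (k + l) (wedge k l \<alpha> \<beta>)"
proof -
  have "wedge k l \<alpha> \<beta> = (\<lambda>v. (1 / (fact k * fact l)) *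
      (\<Sum>\<sigma> | \<sigma> permutes {..<k + l}. of_int (sign \<sigma>) *
         ((\<lambda>v. \<alpha> v * \<beta> (\<lambda>i. v (k + i))) (\<lambda>i. v (\<sigma> i)))))"
    by (simp add: wedge_def fun_eq_iff mult.assoc)
  then show ?thesis
    by (simp only: alternating_scale[OF alternating_alternation[OF multilinear_form_product[OF assms]]])
qed

text \<open>Contraction with fixed vectors in the last slots; together with its mirror image it
  turns the determinant into constant forms of lower degree.\<close>

lemma alternating_fill_right:
  fixes \<alpha> :: "'n::finite alt"
  assumes alt: "alternating n \<alpha>" and "k \<le> n"
  shows "alternating k (\<lambda>v. \<alpha> (\<lambda>i. if i < k then v i else w i))"
  unfolding alternating_iff multilinear_form_def
proof (intro conjI allI impI)
  fix v v' :: "nat \<Rightarrow> real ^ 'n" assume "\<forall>i<k. v i = v' i"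
  then show "\<alpha> (\<lambda>i. if i < k then v i else w i) = \<alpha> (\<lambda>i. if i < k then v' i else w i)"
    by (intro arg_cong[of _ _ \<alpha>]) auto
next
  fix v :: "nat \<Rightarrow> real ^ 'n" and i assume "i < k"
  have "(\<lambda>j. if j < k then (v(i := u)) j else w j) = (\<lambda>j. if j < k then v j else w j)(i := u)" for u
    using \<open>i < k\<close> by (auto simp: fun_eq_iff)
  then show "linear (\<lambda>u. \<alpha> (\<lambda>j. if j < k then (v(i := u)) j else w j))"
    using multilinear_form_linear[OF alternating_multilinear[OF alt], of i] \<open>i < k\<close> \<open>k \<le> n\<close> by simp
next
  fix v :: "nat \<Rightarrow> real ^ 'n" and i j assume "i < k" "j < k" "i \<noteq> j \<and> v i = v j"
  then show "\<alpha> (\<lambda>i. if i < k then v i else w i) = 0"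
    using \<open>k \<le> n\<close> by (intro alternating_repeated[OF alt, of i j]) auto
qed

lemma alternating_fill_left:
  fixes \<alpha> :: "'n::finite alt"
  assumes alt: "alternating (k + l) \<alpha>"
  shows "alternating l (\<lambda>v. \<alpha> (\<lambda>i. if i < k then w i else v (i - k)))"
  unfolding alternating_iff multilinear_form_def
proof (intro conjI allI impI)
  fix v v' :: "nat \<Rightarrow> real ^ 'n" assume "\<forall>i<l. v i = v' i"
  then show "\<alpha> (\<lambda>i. if i < k then w i else v (i - k)) = \<alpha> (\<lambda>i. if i < k then w i else v' (i - k))"
    by (intro multilinear_form_cong[OF alternating_multilinear[OF alt]]) auto
next
  fix v :: "nat \<Rightarrow> real ^ 'n" and i assume "i < l"
  have "(\<lambda>j. if j < k then w j else (v(i := u)) (j - k)) = (\<lambda>j. if j < k then w j else v (j - k))(k + i := u)" for u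
    by (auto simp: fun_eq_iff)
  then show "linear (\<lambda>u. \<alpha> (\<lambda>j. if j < k then w j else (v(i := u)) (j - k)))"
    using multilinear_form_linear[OF alternating_multilinear[OF alt], of "k + i"] \<open>i < l\<close> by simp
next
  fix v :: "nat \<Rightarrow> real ^ 'n" and i j assume "i < l" "j < l" "i \<noteq> j \<and> v i = v j"
  then show "\<alpha> (\<lambda>i. if i < k then w i else v (i - k)) = 0"
    by (intro alternating_repeated[OF alt, of "k + i" "k + j"]) auto
qed

section \<open>The Euclidean volume form and the constant coordinate forms\<close>

definition vol_form :: "'n::finite alt" where
  "vol_form v = det (\<chi> a. v (to_nat_on UNIV a))"

lemma to_nat_on_less: "to_nat_on UNIV (a::'n::finite) < CARD('n)"
  using to_nat_on_finite[of "UNIV::'n set"] by (auto simp: bij_betw_def)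

lemma to_nat_on_cases:
  assumes "i < CARD('n::finite)"
  obtains a :: "'n::finite" where "i = to_nat_on UNIV a"
  using to_nat_on_finite[of "UNIV::'n set"] assms by (auto simp: bij_betw_def image_iff set_eq_iff)

lemma to_nat_on_eq_iff: "to_nat_on UNIV (a::'n::finite) = to_nat_on UNIV b \<longleftrightarrow> a = b"
  using to_nat_on_finite[of "UNIV::'n set"] by (auto simp: bij_betw_def inj_on_def)

text \<open>\<open>to_nat_on UNIV\<close> inverts the enumeration behind \<open>std_frame\<close>,
  so the matrix is the identity and \<open>vol_form\<close> has the chosen orientation.\<close>

lemma vol_form_std_frame: "vol_form (std_frame :: nat \<Rightarrow> real ^ 'n::finite) = 1"
proof -
  have "(\<chi> a. std_frame (to_nat_on UNIV a)) = (mat 1 :: real ^ 'n ^ 'n)"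
    by (auto simp: vec_eq_iff std_frame_def axis_def mat_def)
  then show ?thesis
    by (simp add: vol_form_def)
qed

lemma alternating_vol_form: "alternating CARD('n) (vol_form :: 'n::finite alt)"
  unfolding alternating_iff multilinear_form_def
proof (intro conjI allI impI)
  fix v w :: "nat \<Rightarrow> real ^ 'n" assume "\<forall>i<CARD('n). v i = w i"
  then show "vol_form v = vol_form w"
    by (simp add: vol_form_def to_nat_on_less)
next
  fix v :: "nat \<Rightarrow> real ^ 'n" and i assume "i < CARD('n)"
  then obtain a :: 'n where a: "i = to_nat_on UNIV a"
    by (rule to_nat_on_cases)
  have eq: "vol_form (v(i := u)) = det (\<chi> b. if b = a then u else v (to_nat_on UNIV b))" for u
    unfolding vol_form_def by (rule arg_cong[of _ _ det]) (auto simp: vec_eq_iff a to_nat_on_eq_iff)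
  show "linear (\<lambda>u. vol_form (v(i := u)))"
    unfolding eq using det_row_add[of a "\<lambda>_. x" "\<lambda>_. y" "\<lambda>b. v (to_nat_on UNIV b)" for x y]
      det_row_mul[of a c "\<lambda>_. x" "\<lambda>b. v (to_nat_on UNIV b)" for x c]
    by (intro linearI) (simp_all only: scalar_mult_eq_scaleR real_scaleR_def)
next
  fix v :: "nat \<Rightarrow> real ^ 'n" and i j assume i: "i < CARD('n)" and j: "j < CARD('n)" and ij: "i \<noteq> j \<and> v i = v j"
  obtain a :: 'n where a: "i = to_nat_on UNIV a"
    using i by (rule to_nat_on_cases)
  obtain b :: 'n where b: "j = to_nat_on UNIV b"
    using j by (rule to_nat_on_cases)
  show "vol_form v = 0"
    unfolding vol_form_def using ij
    by (intro det_identical_rows[of a b]) (auto simp: a b row_def)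
qed

text \<open>The Leibniz formula has n! terms of absolute value at most 1. Hadamard's inequality
  would give 1, but any constant will do.\<close>

lemma abs_vol_form_le:
  fixes v :: "nat \<Rightarrow> real ^ 'n::finite"
  assumes "\<And>i. i < CARD('n) \<Longrightarrow> norm (v i) \<le> 1"
  shows "\<bar>vol_form v\<bar> \<le> fact CARD('n)"
proof -
  have "\<bar>of_int (sign p) * (\<Prod>i\<in>UNIV. v (to_nat_on UNIV i) $ p i)\<bar> \<le> 1" for p :: "'n \<Rightarrow> 'n"
  proof -
    have "\<bar>v (to_nat_on UNIV i) $ p i\<bar> \<le> 1" for i
      using component_le_norm_cart[of "v (to_nat_on UNIV i)" "p i"] assms[OF to_nat_on_less, of i]
      by linarith
    then show ?thesis
      by (auto simp: abs_mult sign_def abs_prod intro!: prod_le_1)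
  qed
  then have "\<bar>vol_form v\<bar> \<le> (\<Sum>p | p permutes (UNIV :: 'n set). 1)"
    unfolding vol_form_def det_def by (intro order.trans[OF sum_abs] sum_mono) auto
  also have "\<dots> = fact CARD('n)"
    by (simp add: card_permutations)
  finally show ?thesis .
qed

text \<open>The product of the first k coordinate differentials in the order of
  \<open>std_frame\<close>, written as a determinant with the remaining rows frozen.
  \<open>tail_form\<close> is the complementary product, which reads its arguments from slot k of
  the determinant on.\<close>

definition head_form :: "nat \<Rightarrow> 'n::finite alt" where
  "head_form k v = vol_form (\<lambda>i. if i < k then v i else std_frame i)"

definition tail_form :: "nat \<Rightarrow> 'n::finite alt" where
  "tail_form k v = vol_form (\<lambda>i. if i < k then std_frame i else v (i - k))"

lemma alternating_head_form: "k \<le> CARD('n) \<Longrightarrow> alternating k (head_form k :: 'n::finite alt)"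
  using alternating_fill_right[OF alternating_vol_form, of k std_frame]
  by (simp add: head_form_def[abs_def])

lemma alternating_tail_form: "k + l = CARD('n) \<Longrightarrow> alternating l (tail_form k :: 'n::finite alt)"
  using alternating_fill_left[of k l vol_form std_frame] alternating_vol_form[where 'n='n]
  by (simp add: tail_form_def[abs_def])

lemma norm_std_frame [simp]: "norm (std_frame i) = 1"
  by (simp add: std_frame_def)

lemma abs_head_form_le:
  fixes v :: "nat \<Rightarrow> real ^ 'n::finite"
  assumes "\<And>i. i < k \<Longrightarrow> norm (v i) \<le> 1"
  shows "\<bar>head_form k v\<bar> \<le> fact CARD('n)"
  unfolding head_form_def using assms by (intro abs_vol_form_le) auto

lemma abs_tail_form_le:
  fixes v :: "nat \<Rightarrow> real ^ 'n::finite"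
  assumes "\<And>i. i < l \<Longrightarrow> norm (v i) \<le> 1" "k + l = CARD('n)"
  shows "\<bar>tail_form k v\<bar> \<le> fact CARD('n)"
  unfolding tail_form_def using assms by (intro abs_vol_form_le) auto

text \<open>A repeated index would make the alternating form vanish, so a non-zero value forces
  \<rho> to be injective on the n indices, hence a permutation.\<close>

lemma vol_form_frame_image:
  fixes \<rho> :: "nat \<Rightarrow> nat"
  assumes "\<And>i. i < CARD('n::finite) \<Longrightarrow> \<rho> i < CARD('n)" "\<And>i. i \<ge> CARD('n) \<Longrightarrow> \<rho> i = i"
    and nz: "vol_form (\<lambda>i. std_frame (\<rho> i) :: real ^ 'n) \<noteq> 0"
  shows "\<rho> permutes {..<CARD('n)}"
    and "vol_form (\<lambda>i. std_frame (\<rho> i) :: real ^ 'n) = of_int (sign \<rho>)"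
proof -
  have inj: "inj_on \<rho> {..<CARD('n)}"
  proof (rule inj_onI, rule ccontr)
    fix i j assume "i \<in> {..<CARD('n)}" "j \<in> {..<CARD('n)}" "\<rho> i = \<rho> j" "i \<noteq> j"
    then have "vol_form (\<lambda>i. std_frame (\<rho> i) :: real ^ 'n) = 0"
      by (intro alternating_repeated[OF alternating_vol_form, of i j]) auto
    with nz show False by simp
  qed
  have "\<rho> ` {..<CARD('n)} = {..<CARD('n)}"
    using assms(1) inj by (intro card_subset_eq) (auto simp: card_image)
  with inj show p: "\<rho> permutes {..<CARD('n)}"
    using assms(2) by (intro bij_imp_permutes) (auto simp: bij_betw_def)
  show "vol_form (\<lambda>i. std_frame (\<rho> i) :: real ^ 'n) = of_int (sign \<rho>)"
    using alternating_permutes[OF alternating_vol_form p, of "std_frame :: nat \<Rightarrow> real ^ 'n"]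
    by (simp add: o_def vol_form_std_frame)
qed

text \<open>Every non-zero summand of the wedge product is \<open>1\<close>, and the identity contributes one.\<close>

lemma wedge_head_tail_pos:
  assumes kl: "k + l = CARD('n::finite)"
  shows "wedge k l (head_form k) (tail_form k) (std_frame :: nat \<Rightarrow> real ^ 'n) > 0"
proof -
  let ?e = "std_frame :: nat \<Rightarrow> real ^ 'n"
  let ?g = "\<lambda>\<sigma>. of_int (sign \<sigma>) * head_form k (\<lambda>i. ?e (\<sigma> i)) * tail_form k (\<lambda>i. ?e (\<sigma> (k + i)))"
  have nonneg: "?g \<sigma> \<ge> 0" if \<sigma>: "\<sigma> permutes {..<k + l}" for \<sigma>
  proof (cases "?g \<sigma> = 0")
    case False
    \<comment> \<open>If the summand is non-zero, \<sigma> preserves both blocks of indices: \<rho>1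
      and \<rho>2 are its restrictions extended by the identity, the two forms take their signs as
      values, and these cancel against the sign of \<sigma>.\<close>
    define \<rho>1 where "\<rho>1 i = (if i < k then \<sigma> i else i)" for i
    define \<rho>2 where "\<rho>2 i = (if i < k then i else \<sigma> i)" for i
    have "(\<lambda>i. if i < k then ?e (\<sigma> i) else ?e i) = (\<lambda>i. ?e (\<rho>1 i))"
      "(\<lambda>i. if i < k then ?e i else ?e (\<sigma> (k + (i - k)))) = (\<lambda>i. ?e (\<rho>2 i))"
      by (auto simp: \<rho>1_def \<rho>2_def)
    then have eqs: "head_form k (\<lambda>i. ?e (\<sigma> i)) = vol_form (\<lambda>i. ?e (\<rho>1 i))"
      "tail_form k (\<lambda>i. ?e (\<sigma> (k + i))) = vol_form (\<lambda>i. ?e (\<rho>2 i))"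
      by (simp_all add: head_form_def tail_form_def)
    have less: "\<sigma> i < CARD('n)" if "i < CARD('n)" for i
      using permutes_in_image[OF \<sigma>, of i] that kl by simp
    have ge: "\<sigma> i = i" if "i \<ge> CARD('n)" for i
      using permutes_not_in[OF \<sigma>, of i] that kl by simp
    have p1: "\<rho>1 permutes {..<CARD('n)}" "vol_form (\<lambda>i. ?e (\<rho>1 i)) = of_int (sign \<rho>1)"
      using vol_form_frame_image[of \<rho>1, where 'n='n] False less ge kl unfolding eqs
      by (auto simp: \<rho>1_def)
    have p2: "\<rho>2 permutes {..<CARD('n)}" "vol_form (\<lambda>i. ?e (\<rho>2 i)) = of_int (sign \<rho>2)"
      using vol_form_frame_image[of \<rho>2, where 'n='n] False less ge kl unfolding eqs
      by (auto simp: \<rho>2_def)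
    have "\<sigma> = \<rho>1 \<circ> \<rho>2"
    proof
      fix i
      \<comment> \<open>Otherwise \<rho>2, which fixes indices below k, would take the value
        \<sigma> i both at i and at \<sigma> i.\<close>
      have "\<not> \<sigma> i < k" if "\<not> i < k"
      proof
        assume "\<sigma> i < k"
        then have "\<rho>2 (\<sigma> i) = \<rho>2 i"
          using that by (simp add: \<rho>2_def)
        then have "\<sigma> i = i"
          using permutes_inj[OF p2(1)] by (auto dest: injD)
        with \<open>\<sigma> i < k\<close> that show False by simp
      qed
      then show "\<sigma> i = (\<rho>1 \<circ> \<rho>2) i"
        by (simp add: \<rho>1_def \<rho>2_def)
    qed
    then have "sign \<sigma> = sign \<rho>1 * sign \<rho>2"
      using p1 p2 by (auto intro!: sign_compose permutation_permutes[THEN iffD2])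
    then have "?g \<sigma> = (of_int (sign \<rho>1 * sign \<rho>1) :: real) * of_int (sign \<rho>2 * sign \<rho>2)"
      unfolding eqs p1 p2 by (simp only: of_int_mult mult_ac)
    then show ?thesis
      by simp
  next
    case True
    then show ?thesis by (rule eq_refl[OF sym])
  qed
  have "?g id = 1"
  proof -
    have "(\<lambda>i. if i < k then ?e i else ?e (k + (i - k))) = ?e"
      by auto
    then show ?thesis
      by (simp add: head_form_def tail_form_def vol_form_std_frame)
  qed
  moreover have "id \<in> {\<sigma>. \<sigma> permutes {..<k + l}}"
    by (simp add: permutes_id)
  ultimately have "0 < sum ?g {\<sigma>. \<sigma> permutes {..<k + l}}"
    using nonneg by (intro sum_pos2[of _ id]) (auto simp: finite_permutations)
  then show ?thesis
    unfolding wedge_def by simp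
qed

subsection \<open>The hyperbolic metric\<close>

text \<open>For a unit vector u this is the symmetric operator with eigenvalue 1 along u and s on
  the orthogonal complement. For u = 0 it is s times the identity, which with s = 1 covers the
  pole.\<close>

definition radial_matrix :: "real \<Rightarrow> real ^ 'n \<Rightarrow> real ^ 'n ^ 'n::finite" where
  "radial_matrix s u = (\<chi> i j. (1 - s) * (u $ i * u $ j) + (if i = j then s else 0))"

lemma radial_matrix_1 [simp]: "radial_matrix 1 u = mat 1"
  by (auto simp: radial_matrix_def mat_def vec_eq_iff)

lemma radial_matrix_mult_vec: "radial_matrix s u *v v = s *\<^sub>R v + ((1 - s) * (u \<bullet> v)) *\<^sub>R u"
proof (rule vec_eq_iff[THEN iffD2], rule allI)
  fix i
  have "(radial_matrix s u *v v) $ i =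
      (\<Sum>j\<in>UNIV. (1 - s) * u $ i * (u $ j * v $ j) + (if i = j then s * v $ j else 0))"
    unfolding matrix_vector_mult_def by (auto simp: radial_matrix_def algebra_simps intro!: sum.cong)
  also have "\<dots> = (1 - s) * u $ i * (u \<bullet> v) + s * v $ i"
    by (simp add: sum.distrib inner_vec_def flip: sum_distrib_left)
  finally show "(radial_matrix s u *v v) $ i = (s *\<^sub>R v + ((1 - s) * (u \<bullet> v)) *\<^sub>R u) $ i"
    by simp
qed

text \<open>Such matrices share their eigenspaces, so eigenvalues multiply. The assumption allows u
  = 0 besides unit vectors, so that \<open>sgn x\<close> can be inserted without separating the
  pole.\<close>

lemma radial_matrix_mult:
  assumes "(u \<bullet> u) *\<^sub>R u = u"
  shows "radial_matrix s u ** radial_matrix t u = radial_matrix (s * t) u"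
proof -
  have "(radial_matrix s u ** radial_matrix t u) *v v = radial_matrix (s * t) u *v v" for v
  proof -
    have "(radial_matrix s u ** radial_matrix t u) *v v
        = (s * t) *\<^sub>R v + (s * (1 - t) * (u \<bullet> v) + (1 - s) * t * (u \<bullet> v)) *\<^sub>R u
          + ((1 - s) * (1 - t) * (u \<bullet> v)) *\<^sub>R ((u \<bullet> u) *\<^sub>R u)"
      unfolding matrix_vector_mul_assoc[symmetric] radial_matrix_mult_vec
      by (simp add: inner_add_right vec_eq_iff algebra_simps)
    also have "\<dots> = radial_matrix (s * t) u *v v"
      unfolding assms radial_matrix_mult_vec by (simp add: vec_eq_iff algebra_simps)
    finally show ?thesis .
  qed
  then show ?thesis
    by (simp add: matrix_eq)
qed

lemma matrix_inv_radial_matrix: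
  fixes u :: "real ^ 'n::finite"
  assumes "(u \<bullet> u) *\<^sub>R u = u" "s \<noteq> 0"
  shows "matrix_inv (radial_matrix s u) = radial_matrix (1 / s) u"
proof -
  let ?A = "radial_matrix s u" and ?B = "radial_matrix (1 / s) u"
  have AB: "?A ** ?B = mat 1" "?B ** ?A = mat 1"
    using assms by (simp_all add: radial_matrix_mult)
  then have "invertible ?A"
    by (auto simp: invertible_def)
  have right: "?A ** matrix_inv ?A = mat 1"
    unfolding matrix_inv_def using someI_ex[OF \<open>invertible ?A\<close>[unfolded invertible_def]] by blast
  have "matrix_inv ?A = (?B ** ?A) ** matrix_inv ?A"
    by (simp add: AB)
  also have "\<dots> = ?B ** (?A ** matrix_inv ?A)"
    by (rule matrix_mul_assoc[symmetric])
  also have "\<dots> = ?B"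
    by (simp add: right)
  finally show ?thesis .
qed

text \<open>An orthogonal matrix taking a coordinate axis to u conjugates the matrix to a diagonal
  one, with a single entry 1 and all others s.\<close>

lemma det_radial_matrix:
  fixes u :: "real ^ 'n::finite"
  assumes "norm u = 1"
  shows "det (radial_matrix s u) = s ^ (CARD('n) - 1)"
proof -
  fix k :: 'n
  let ?e = "axis k 1 :: real ^ 'n"
  obtain A where A: "orthogonal_matrix A" "A *v ?e = u"
    using orthogonal_matrix_exists_basis[OF assms] by blast
  have "orthogonal_transformation ((*v) A)"
    using A by (simp add: orthogonal_transformation_matrix)
  then have inner: "(A *v v) \<bullet> (A *v w) = v \<bullet> w" for v w
    by (simp add: orthogonal_transformation_def)
  have "(radial_matrix s u ** A) *v v = (A ** radial_matrix s ?e) *v v" for v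
    unfolding matrix_vector_mul_assoc[symmetric] radial_matrix_mult_vec
    using inner[of ?e v] A(2)
    by (simp add: matrix_vector_right_distrib matrix_vector_mult_scaleR)
  then have "det (radial_matrix s u ** A) = det (A ** radial_matrix s ?e)"
    by (metis matrix_eq)
  moreover have "det A \<noteq> 0"
    using A(1) by (metis det_orthogonal_matrix zero_neq_neg_one zero_neq_one)
  ultimately have "det (radial_matrix s u) = det (radial_matrix s ?e)"
    by (simp add: det_mul)
  also have "\<dots> = (\<Prod>i\<in>UNIV. radial_matrix s ?e $ i $ i)"
    by (intro det_diagonal) (auto simp: radial_matrix_def axis_def)
  also have "\<dots> = (\<Prod>i\<in>UNIV. if i \<in> UNIV - {k} then s else 1)"
    by (intro prod.cong) (auto simp: radial_matrix_def axis_def)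
  also have "\<dots> = s ^ card (UNIV - {k})"
    by (simp add: prod.If_cases Int_absorb1 del: Diff_iff)
  also have "\<dots> = s ^ (CARD('n) - 1)"
    by (simp add: card_Diff_singleton)
  finally show ?thesis .
qed

text \<open>The factor by which tangential vectors are longer in the hyperbolic than in the
  Euclidean metric, with its limit 1 at the pole.\<close>

definition hyp_weight :: "real ^ 'n::finite \<Rightarrow> real" where
  "hyp_weight x = (if x = 0 then 1 else sinh (norm x) / norm x)"

lemma real_le_sinh:
  fixes y :: real
  assumes "y \<ge> 0"
  shows "y \<le> sinh y"
proof -
  have "sinh 0 - 0 \<le> sinh y - y"
    using assms
    by (intro DERIV_nonneg_imp_nondecreasing[of 0 y "\<lambda>y. sinh y - y"])
       (auto intro!: exI derivative_eq_intros simp: cosh_real_ge_1)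
  then show ?thesis by simp
qed

text \<open>With y = r/2 the doubling formula gives sinh r / r = (sinh y / y) cosh y \<ge> cosh y;
  halving the exponent removes the denominator.\<close>

lemma hyp_weight_ge_exp: "exp (norm x / 2) / 2 \<le> hyp_weight x"
proof (cases "x = 0")
  case False
  define y where "y = norm x / 2"
  have "y > 0" using False by (simp add: y_def)
  have "exp y / 2 \<le> cosh y"
    by (simp add: cosh_def)
  also have "\<dots> = y / y * cosh y"
    using \<open>y > 0\<close> by simp
  also have "\<dots> \<le> sinh y / y * cosh y"
    using \<open>y > 0\<close> real_le_sinh[of y] by (intro mult_right_mono divide_right_mono) auto
  also have "\<dots> = hyp_weight x"
    using False sinh_double[of y] \<open>y > 0\<close> by (simp add: hyp_weight_def y_def)
  finally show ?thesis
    by (simp add: y_def)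
qed (simp add: hyp_weight_def)

lemma hyp_weight_ge_1: "1 \<le> hyp_weight x"
  using real_le_sinh[of "norm x"] by (auto simp: hyp_weight_def field_simps)

lemma hyp_weight_pos: "0 < hyp_weight x"
  using hyp_weight_ge_1[of x] by linarith

lemma borel_measurable_hyp_weight [measurable]: "hyp_weight \<in> borel_measurable borel"
proof -
  have [measurable]: "(\<lambda>r::real. sinh r) \<in> borel_measurable borel"
    by (intro borel_measurable_continuous_onI continuous_intros)
  show ?thesis
    unfolding hyp_weight_def[abs_def] by measurable
qed

lemma sgn_projection: "(sgn x \<bullet> sgn x) *\<^sub>R sgn x = sgn (x :: 'a::real_inner)"
  by (cases "x = 0") (simp_all add: norm_sgn flip: power2_norm_eq_inner)

lemma hyperbolic_metric_eq: "hyperbolic_metric x = radial_matrix ((hyp_weight x)\<^sup>2) (sgn x)"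
  by (cases "x = 0")
     (auto simp: vec_eq_iff hyperbolic_metric_def radial_matrix_def hyp_weight_def sgn_div_norm
        Let_def power2_eq_square algebra_simps divide_inverse)

lemma matrix_inv_hyperbolic_metric:
  "matrix_inv (hyperbolic_metric x) = radial_matrix (1 / (hyp_weight x)\<^sup>2) (sgn x)"
  unfolding hyperbolic_metric_eq using hyp_weight_pos[of x]
  by (intro matrix_inv_radial_matrix sgn_projection) simp

lemma sqrt_det_hyperbolic_metric:
  fixes x :: "real ^ 'n::finite"
  shows "sqrt (det (hyperbolic_metric x)) = hyp_weight x ^ (CARD('n) - 1)"
proof -
  have "det (hyperbolic_metric x) = ((hyp_weight x)\<^sup>2) ^ (CARD('n) - 1)"
  proof (cases "x = 0")
    case True
    then show ?thesis
      by (simp add: hyperbolic_metric_eq hyp_weight_def)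
  next
    case False
    then show ?thesis
      unfolding hyperbolic_metric_eq by (intro det_radial_matrix) (simp add: norm_sgn)
  qed
  then show ?thesis
    using hyp_weight_pos[of x] by (simp add: real_sqrt_power)
qed

text \<open>The vectors below are the images of the coordinate frame under the square root of the
  inverse metric, so they form an orthonormal basis for the hyperbolic metric.\<close>

definition hyp_frame :: "real ^ 'n \<Rightarrow> real ^ 'n \<Rightarrow> real ^ 'n::finite" where
  "hyp_frame x v = radial_matrix (1 / hyp_weight x) (sgn x) *v v"

lemma linear_hyp_frame: "linear (hyp_frame x)"
  unfolding hyp_frame_def[abs_def] by simp

text \<open>The frame consists of the columns of the symmetric square root S of the inverse metric.
  Expanding each square in coordinates and summing over K contracts S with S to the inverse metric.
  All index maps K occur, not only increasing ones, hence the division by k!.\<close>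

lemma alt_norm_hyperbolic_metric:
  fixes \<alpha> :: "'n::finite alt"
  assumes "multilinear_form k \<alpha>"
  shows "alt_norm (hyperbolic_metric x) k \<alpha> =
    sqrt ((\<Sum>K \<in> {..<k} \<rightarrow>\<^sub>E UNIV. (\<alpha> (\<lambda>a. hyp_frame x (axis (K a) 1)))\<^sup>2) / fact k)"
proof -
  define S where "S = radial_matrix (1 / hyp_weight x) (sgn x)"
  let ?P = "{..<k} \<rightarrow>\<^sub>E (UNIV :: 'n set)"
  let ?\<alpha> = "\<lambda>I :: nat \<Rightarrow> 'n. \<alpha> (\<lambda>a. axis (I a) 1)"
  have ent: "hyp_frame x (axis j 1) $ i = S $ i $ j" for i j
    by (simp add: hyp_frame_def S_def matrix_vector_mult_basis column_def)
  have sym: "S $ i $ j = S $ j $ i" for i j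
    by (simp add: S_def radial_matrix_def mult.commute)
  have "S ** S = matrix_inv (hyperbolic_metric x)"
    unfolding S_def matrix_inv_hyperbolic_metric
    by (simp add: radial_matrix_mult sgn_projection power2_eq_square)
  then have SS: "(\<Sum>m\<in>UNIV. S $ i $ m * S $ j $ m) = matrix_inv (hyperbolic_metric x) $ i $ j" for i j
    by (auto simp: matrix_matrix_mult_def sym[of j] dest!: arg_cong[where f = "\<lambda>A. A $ i $ j"])
  have "(\<Sum>K\<in>?P. (\<alpha> (\<lambda>a. hyp_frame x (axis (K a) 1)))\<^sup>2)
      = (\<Sum>K\<in>?P. (\<Sum>I\<in>?P. (\<Prod>a<k. S $ I a $ K a) * ?\<alpha> I)\<^sup>2)"
    unfolding multilinear_form_expand[OF assms, of "\<lambda>a. hyp_frame x (axis (K a) 1)" for K] ent ..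
  also have "\<dots> = (\<Sum>K\<in>?P. \<Sum>I\<in>?P. \<Sum>J\<in>?P. (\<Prod>a<k. S $ I a $ K a * S $ J a $ K a) * ?\<alpha> I * ?\<alpha> J)"
    by (simp add: power2_eq_square sum_product prod.distrib mult_ac)
  also have "\<dots> = (\<Sum>I\<in>?P. \<Sum>J\<in>?P. \<Sum>K\<in>?P. (\<Prod>a<k. S $ I a $ K a * S $ J a $ K a) * ?\<alpha> I * ?\<alpha> J)"
    by (subst sum.swap, rule sum.cong[OF refl], rule sum.swap)
  also have "\<dots> = (\<Sum>I\<in>?P. \<Sum>J\<in>?P. (\<Prod>a<k. matrix_inv (hyperbolic_metric x) $ I a $ J a) * ?\<alpha> I * ?\<alpha> J)"
    \<comment> \<open>The sum over K of products factors into a product of sums over single indices,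
      each an entry of S S.\<close>
    by (intro sum.cong refl) (simp only: prod_sum_PiE finite SS[symmetric] sum_distrib_right[symmetric] finite_lessThan)
  finally show ?thesis
    by (simp add: alt_norm_def)
qed

lemma alt_norm_nonneg: "multilinear_form k \<alpha> \<Longrightarrow> 0 \<le> alt_norm (hyperbolic_metric x) k \<alpha>"
  by (simp add: alt_norm_hyperbolic_metric sum_nonneg)

lemma abs_le_alt_norm:
  fixes \<alpha> :: "'n::finite alt"
  assumes "multilinear_form k \<alpha>" and "K \<in> {..<k} \<rightarrow>\<^sub>E UNIV"
  shows "\<bar>\<alpha> (\<lambda>a. hyp_frame x (axis (K a) 1))\<bar> \<le> sqrt (fact k) * alt_norm (hyperbolic_metric x) k \<alpha>"
proof -
  have "\<bar>\<alpha> (\<lambda>a. hyp_frame x (axis (K a) 1))\<bar> = sqrt ((\<alpha> (\<lambda>a. hyp_frame x (axis (K a) 1)))\<^sup>2)"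
    by simp
  also have "\<dots> \<le> sqrt (\<Sum>K \<in> {..<k} \<rightarrow>\<^sub>E UNIV. (\<alpha> (\<lambda>a. hyp_frame x (axis (K a) 1)))\<^sup>2)"
    by (rule real_sqrt_le_mono, rule member_le_sum[OF assms(2)]) (simp_all add: finite_PiE)
  also have "\<dots> = sqrt (fact k) * alt_norm (hyperbolic_metric x) k \<alpha>"
    unfolding alt_norm_hyperbolic_metric[OF assms(1)] by (simp flip: real_sqrt_mult)
  finally show ?thesis .
qed

lemma hyp_frame_tangential:
  assumes "x \<bullet> v = 0"
  shows "hyp_frame x (hyp_weight x *\<^sub>R v) = v"
  using assms hyp_weight_pos[of x]
  by (simp add: hyp_frame_def radial_matrix_mult_vec sgn_div_norm)

text \<open>Multiplied by w, a tangential vector is mapped back to itself by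
  \<open>hyp_frame\<close>, so k arguments cost w^k. The factor n^k counts index maps and sqrt k!
  undoes the normalisation of \<open>alt_norm\<close>.\<close>

lemma tangential_bound:
  fixes \<alpha> :: "'n::finite alt"
  assumes ml: "multilinear_form k \<alpha>"
    and tan: "\<And>i. i < k \<Longrightarrow> x \<bullet> y i = 0" and le: "\<And>i. i < k \<Longrightarrow> norm (y i) \<le> 1"
  shows "\<bar>\<alpha> y\<bar> \<le> real CARD('n) ^ k * sqrt (fact k) * hyp_weight x ^ k * alt_norm (hyperbolic_metric x) k \<alpha>"
proof -
  let ?P = "{..<k} \<rightarrow>\<^sub>E (UNIV :: 'n set)" and ?w = "hyp_weight x"
  let ?b = "sqrt (fact k) * alt_norm (hyperbolic_metric x) k \<alpha>"
  have "\<alpha> y = \<alpha> (\<lambda>i. hyp_frame x (?w *\<^sub>R y i))"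
    using tan by (intro multilinear_form_cong[OF ml]) (simp add: hyp_frame_tangential)
  also have "\<dots> = (\<Sum>I\<in>?P. (\<Prod>a<k. (?w *\<^sub>R y a) $ I a) * \<alpha> (\<lambda>a. hyp_frame x (axis (I a) 1)))"
    by (rule multilinear_form_expand[OF multilinear_form_compose[OF ml linear_hyp_frame]])
  finally have "\<bar>\<alpha> y\<bar> \<le> (\<Sum>I\<in>?P. \<bar>(\<Prod>a<k. (?w *\<^sub>R y a) $ I a)\<bar> * \<bar>\<alpha> (\<lambda>a. hyp_frame x (axis (I a) 1))\<bar>)"
    using sum_abs[of "\<lambda>I. (\<Prod>a<k. (?w *\<^sub>R y a) $ I a) * \<alpha> (\<lambda>a. hyp_frame x (axis (I a) 1))" ?P]
    by (simp add: abs_mult)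
  also have "\<dots> \<le> (\<Sum>I\<in>?P. ?w ^ k * ?b)"
  proof (intro sum_mono mult_mono)
    fix I assume I: "I \<in> ?P"
    have "\<bar>\<Prod>a<k. (?w *\<^sub>R y a) $ I a\<bar> = (\<Prod>a<k. ?w * \<bar>y a $ I a\<bar>)"
      using hyp_weight_pos[of x] by (simp add: abs_prod abs_mult)
    also have "\<dots> \<le> (\<Prod>a<k. ?w)"
    proof (intro prod_mono conjI)
      fix a assume "a \<in> {..<k}"
      then have "\<bar>y a $ I a\<bar> \<le> 1"
        using le[of a] component_le_norm_cart[of "y a" "I a"] by simp
      then show "?w * \<bar>y a $ I a\<bar> \<le> ?w"
        using hyp_weight_pos[of x] by (simp add: mult_left_le)
    qed (use hyp_weight_pos[of x] in simp)
    finally show "\<bar>\<Prod>a<k. (?w *\<^sub>R y a) $ I a\<bar> \<le> ?w ^ k"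
      by simp
    show "\<bar>\<alpha> (\<lambda>a. hyp_frame x (axis (I a) 1))\<bar> \<le> ?b"
      by (rule abs_le_alt_norm[OF ml I])
  qed (use hyp_weight_pos[of x] in auto)
  also have "\<dots> = real CARD('n) ^ k * sqrt (fact k) * ?w ^ k * alt_norm (hyperbolic_metric x) k \<alpha>"
    by (simp add: card_funcsetE)
  finally show ?thesis .
qed

lemma multilinear_form_scale:
  fixes \<alpha> :: "'n::finite alt"
  assumes "multilinear_form k \<alpha>"
  shows "\<alpha> (\<lambda>i. r i *\<^sub>R v i) = (\<Prod>i<k. r i) * \<alpha> v"
  unfolding multilinear_form_expand[OF assms, of v]
    multilinear_form_expand[OF assms, of "\<lambda>i. r i *\<^sub>R v i"]
  by (simp add: prod.distrib sum_distrib_left mult.assoc)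

text \<open>Since \<open>sgn 0 = 0\<close>, every vector counts as tangential at the pole.\<close>

definition tangential_part :: "real ^ 'n \<Rightarrow> real ^ 'n \<Rightarrow> real ^ 'n::finite" where
  "tangential_part x v = v - (sgn x \<bullet> v) *\<^sub>R sgn x"

lemma inner_tangential_part: "x \<bullet> tangential_part x v = 0"
proof (cases "x = 0")
  case False
  then show ?thesis
    by (simp add: tangential_part_def inner_diff_right sgn_div_norm)
       (simp add: dot_square_norm power2_eq_square field_simps)
qed simp

lemma tangential_part_split: "v = (sgn x \<bullet> v) *\<^sub>R sgn x + tangential_part x v"
  by (simp add: tangential_part_def)

lemma norm_sgn_le_1: "norm (sgn x) \<le> 1"
  by (simp add: norm_sgn)

lemma norm_tangential_part_le:
  assumes "norm v \<le> 1"
  shows "norm (tangential_part x v) \<le> 1"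
proof -
  have "orthogonal ((sgn x \<bullet> v) *\<^sub>R sgn x) (tangential_part x v)"
    using inner_tangential_part[of x v] by (simp add: orthogonal_def sgn_div_norm)
  then have "(norm v)\<^sup>2 = (norm ((sgn x \<bullet> v) *\<^sub>R sgn x))\<^sup>2 + (norm (tangential_part x v))\<^sup>2"
    using norm_add_Pythagorean tangential_part_split[of v x] by metis
  then have "(norm (tangential_part x v))\<^sup>2 \<le> (norm v)\<^sup>2"
    by (simp del: norm_scaleR)
  then have "norm (tangential_part x v) \<le> norm v"
    by (rule power2_le_imp_le) simp
  then show ?thesis
    using assms by linarith
qed

lemma abs_inner_sgn_le:
  assumes "norm v \<le> 1"
  shows "\<bar>sgn x \<bullet> v\<bar> \<le> 1"
  using Cauchy_Schwarz_ineq2[of "sgn x" v] mult_mono[OF norm_sgn_le_1[of x] assms] by simp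

text \<open>At most one argument of an alternating form can be taken radial; each of the others
  contributes a factor \<open>1 / hyp_weight x\<close>.\<close>

lemma alt_norm_bounded_form:
  fixes \<alpha> :: "'n::finite alt"
  assumes alt: "alternating k \<alpha>" and "k > 0"
    and bound: "\<And>v. (\<And>i. i < k \<Longrightarrow> norm (v i) \<le> 1) \<Longrightarrow> \<bar>\<alpha> v\<bar> \<le> A"
  shows "alt_norm (hyperbolic_metric x) k \<alpha> \<le>
    sqrt (real CARD('n) ^ k) * ((1 + real k) * A) * (1 / hyp_weight x) ^ (k - 1)"
proof -
  define s where "s = 1 / hyp_weight x"
  have s: "0 < s" "s \<le> 1"
    using hyp_weight_ge_1[of x] by (auto simp: s_def)
  have "A \<ge> 0"
    using bound[of "\<lambda>_. 0"] by auto
  note ml = alternating_multilinear[OF alt]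
  \<comment> \<open>The factor 1 + k counts the purely tangential term and the k terms with one
    radial slot.\<close>
  let ?D = "(1 + real k) * A * s ^ (k - 1)"
  have "\<bar>\<alpha> (\<lambda>a. hyp_frame x (axis (K a) 1))\<bar> \<le> ?D" for K :: "nat \<Rightarrow> 'n"
  proof -
    define c where "c a = sgn x \<bullet> axis (K a) 1" for a
    define t where "t a = tangential_part x (axis (K a) 1)" for a
    have t: "norm (t a) \<le> 1" for a
      by (simp add: t_def norm_tangential_part_le)
    have "hyp_frame x (axis (K a) 1) = c a *\<^sub>R sgn x + s *\<^sub>R t a" for a
      by (simp add: hyp_frame_def radial_matrix_mult_vec c_def t_def s_def tangential_part_def algebra_simps)
    then have "\<alpha> (\<lambda>a. hyp_frame x (axis (K a) 1))
        = \<alpha> (\<lambda>a. s *\<^sub>R t a) + (\<Sum>b<k. c b * \<alpha> ((\<lambda>a. s *\<^sub>R t a)(b := sgn x)))"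
      by (simp only: alternating_shift[OF alt])
    moreover have "\<bar>\<alpha> (\<lambda>a. s *\<^sub>R t a)\<bar> \<le> A * s ^ (k - 1)"
    proof -
      have "\<bar>\<alpha> (\<lambda>a. s *\<^sub>R t a)\<bar> = s ^ k * \<bar>\<alpha> t\<bar>"
        using s by (simp add: multilinear_form_scale[OF ml] abs_mult)
      also have "\<dots> \<le> s ^ (k - 1) * A"
        using s t bound[of t] by (intro mult_mono power_decreasing) auto
      finally show ?thesis by (simp add: mult.commute)
    qed
    moreover have "\<bar>c b * \<alpha> ((\<lambda>a. s *\<^sub>R t a)(b := sgn x))\<bar> \<le> A * s ^ (k - 1)" if "b < k" for b
    proof -
      \<comment> \<open>The radial slot b carries no factor s, which leaves k - 1 of them.\<close>
      define r where "r i = (if i = b then 1 else s)" for i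
      have "(\<lambda>a. s *\<^sub>R t a)(b := sgn x) = (\<lambda>i. r i *\<^sub>R (t(b := sgn x)) i)"
        by (auto simp: r_def)
      then have "\<alpha> ((\<lambda>a. s *\<^sub>R t a)(b := sgn x)) = (\<Prod>i<k. r i) * \<alpha> (t(b := sgn x))"
        by (simp only: multilinear_form_scale[OF ml])
      also have "(\<Prod>i<k. r i) = s ^ (k - 1)"
        using that by (simp add: r_def prod.remove[of "{..<k}" b])
      finally have eq: "\<alpha> ((\<lambda>a. s *\<^sub>R t a)(b := sgn x)) = s ^ (k - 1) * \<alpha> (t(b := sgn x))" .
      have "\<bar>c b\<bar> * (s ^ (k - 1) * \<bar>\<alpha> (t(b := sgn x))\<bar>) \<le> 1 * (s ^ (k - 1) * A)"
        using s t bound[of "t(b := sgn x)"] norm_sgn_le_1[of x]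
        by (intro mult_mono mult_left_mono) (auto simp: c_def abs_inner_sgn_le)
      then show ?thesis
        unfolding eq using s by (simp add: abs_mult mult.commute)
    qed
    then have "\<bar>\<Sum>b<k. c b * \<alpha> ((\<lambda>a. s *\<^sub>R t a)(b := sgn x))\<bar> \<le> (\<Sum>b<k. A * s ^ (k - 1))"
      by (intro order.trans[OF sum_abs] sum_mono) auto
    ultimately show ?thesis
      by (simp add: algebra_simps)
  qed
  then have "(\<Sum>K \<in> {..<k} \<rightarrow>\<^sub>E UNIV. (\<alpha> (\<lambda>a. hyp_frame x (axis (K a) 1)))\<^sup>2)
      \<le> (\<Sum>K \<in> {..<k} \<rightarrow>\<^sub>E (UNIV :: 'n set). ?D\<^sup>2)"
    by (intro sum_mono power2_le_iff_abs_le[THEN iffD2]) (use \<open>A \<ge> 0\<close> s in auto)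
  also have "\<dots> = real CARD('n) ^ k * ?D\<^sup>2"
    by (simp add: card_funcsetE)
  finally have "(\<Sum>K \<in> {..<k} \<rightarrow>\<^sub>E UNIV. (\<alpha> (\<lambda>a. hyp_frame x (axis (K a) 1)))\<^sup>2) / fact k
      \<le> real CARD('n) ^ k * ?D\<^sup>2 / 1"
    by (intro frac_le) (auto intro: sum_nonneg)
  then have "alt_norm (hyperbolic_metric x) k \<alpha> \<le> sqrt (real CARD('n) ^ k * ?D\<^sup>2)"
    unfolding alt_norm_hyperbolic_metric[OF ml] by (intro real_sqrt_le_mono) simp
  also have "\<dots> = sqrt (real CARD('n) ^ k) * ?D"
    using \<open>A \<ge> 0\<close> s by (simp add: real_sqrt_mult)
  finally show ?thesis
    by (simp add: s_def mult.assoc)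
qed

section \<open>Exterior multiplication by the radial covector\<close>

definition skip_arg :: "nat \<Rightarrow> (nat \<Rightarrow> 'a) \<Rightarrow> nat \<Rightarrow> 'a" where
  "skip_arg i v = (\<lambda>j. if j < i then v j else v (Suc j))"

text \<open>For alternating \<beta> this is the exterior product of r dr = d(|x|^2 / 2) with
  \<beta>, written as the alternating sum that \<open>ext_deriv\<close> produces.\<close>

definition covector_wedge :: "nat \<Rightarrow> real ^ 'n \<Rightarrow> 'n::finite alt \<Rightarrow> 'n alt" where
  "covector_wedge l x \<beta> v = (\<Sum>i\<le>l. (-1) ^ i * (x \<bullet> v i) * \<beta> (skip_arg i v))"

lemma multilinear_covector_wedge:
  fixes \<beta> :: "'n::finite alt"
  assumes ml: "multilinear_form l \<beta>"
  shows "multilinear_form (Suc l) (covector_wedge l x \<beta>)"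
  unfolding multilinear_form_def
proof (intro conjI allI impI)
  fix v w :: "nat \<Rightarrow> real ^ 'n" assume eq: "\<forall>i<Suc l. v i = w i"
  have "\<beta> (skip_arg i v) = \<beta> (skip_arg i w)" for i
    using eq by (intro multilinear_form_cong[OF ml]) (auto simp: skip_arg_def)
  with eq show "covector_wedge l x \<beta> v = covector_wedge l x \<beta> w"
    by (simp add: covector_wedge_def)
next
  fix v :: "nat \<Rightarrow> real ^ 'n" and m assume "m < Suc l"
  have "linear (\<lambda>u. (-1) ^ i * (x \<bullet> (v(m := u)) i) * \<beta> (skip_arg i (v(m := u))))" if "i \<le> l" for i
  proof (cases "i = m")
    case True
    then have "skip_arg i (v(m := u)) = skip_arg i v" for u
      by (auto simp: skip_arg_def)
    then show ?thesis
      using True by (intro linearI) (simp_all add: inner_add_right algebra_simps)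
  next
    case False
    \<comment> \<open>Removing argument i moves every later argument down by one slot.\<close>
    have eq: "skip_arg i (v(m := u)) = (skip_arg i v)((if m < i then m else m - 1) := u)" for u
      using False by (auto simp: skip_arg_def fun_eq_iff)
    have lin: "linear (\<lambda>u. \<beta> ((skip_arg i v)((if m < i then m else m - 1) := u)))"
      using False \<open>m < Suc l\<close> \<open>i \<le> l\<close> by (intro multilinear_form_linear[OF ml]) auto
    show ?thesis
      unfolding eq using linear_compose_scale_right[OF lin, of "(-1) ^ i * (x \<bullet> v i)"] False by simp
  qed
  then show "linear (\<lambda>u. covector_wedge l x \<beta> (v(m := u)))"
    unfolding covector_wedge_def by (intro linear_compose_sum) auto
qed

lemma abs_covector_wedge_le:
  fixes \<beta> :: "'n::finite alt"
  assumes bound: "\<And>v. (\<And>i. i < l \<Longrightarrow> norm (v i) \<le> 1) \<Longrightarrow> \<bar>\<beta> v\<bar> \<le> A"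
    and v: "\<And>i. i \<le> l \<Longrightarrow> norm (v i) \<le> 1"
  shows "\<bar>covector_wedge l x \<beta> v\<bar> \<le> (real l + 1) * (norm x * A)"
proof -
  have "\<bar>(-1) ^ i * (x \<bullet> v i) * \<beta> (skip_arg i v)\<bar> \<le> norm x * A" if "i \<le> l" for i
  proof -
    have "\<bar>x \<bullet> v i\<bar> \<le> norm x * 1"
      using Cauchy_Schwarz_ineq2[of x "v i"] mult_left_mono[OF v[OF that] norm_ge_zero[of x]] by linarith
    moreover have "\<bar>\<beta> (skip_arg i v)\<bar> \<le> A"
      using v by (intro bound) (auto simp: skip_arg_def)
    ultimately have "\<bar>x \<bullet> v i\<bar> * \<bar>\<beta> (skip_arg i v)\<bar> \<le> norm x * 1 * A"
      by (intro mult_mono) auto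
    then show ?thesis
      by (simp add: abs_mult power_abs)
  qed
  then have "\<bar>covector_wedge l x \<beta> v\<bar> \<le> (\<Sum>i\<le>l. norm x * A)"
    unfolding covector_wedge_def by (intro order.trans[OF sum_abs] sum_mono) auto
  then show ?thesis
    by (simp add: algebra_simps)
qed

text \<open>Decompose the frame into radial and tangential parts.  If the radial vector is an argument
  of \<open>\<alpha>\<close>, then the covector \<open>x\<close> only meets tangential vectors and the summand vanishes.\<close>

lemma wedge_covector_bound:
  fixes \<alpha> \<beta> :: "'n::finite alt"
  assumes ml\<alpha>: "multilinear_form j \<alpha>" and ml\<beta>: "multilinear_form l \<beta>"
    and dim: "j + Suc l = CARD('n)"
    and bound: "\<And>v. (\<And>i. i < l \<Longrightarrow> norm (v i) \<le> 1) \<Longrightarrow> \<bar>\<beta> v\<bar> \<le> A"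
  shows "\<bar>wedge j (Suc l) \<alpha> (covector_wedge l x \<beta>) std_frame\<bar> \<le>
    (1 + real CARD('n)) * fact CARD('n) * (real CARD('n) ^ j * sqrt (fact j)) * ((real l + 1) * A) *
      (norm x * hyp_weight x ^ j * alt_norm (hyperbolic_metric x) j \<alpha>)"
proof -
  let ?W = "wedge j (Suc l) \<alpha> (covector_wedge l x \<beta>)"
  let ?e = "std_frame :: nat \<Rightarrow> real ^ 'n"
  define c where "c a = sgn x \<bullet> ?e a" for a
  define t where "t a = tangential_part x (?e a)" for a
  define P where "P = real CARD('n) ^ j * sqrt (fact j) * hyp_weight x ^ j * alt_norm (hyperbolic_metric x) j \<alpha>"
  define Q where "Q = (real l + 1) * (norm x * A)"
  have t: "norm (t a) \<le> 1" "x \<bullet> t a = 0" for a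
    by (simp_all add: t_def norm_tangential_part_le inner_tangential_part)
  have "A \<ge> 0"
    using bound[of "\<lambda>_. 0"] by auto
  have "P \<ge> 0"
    unfolding P_def using hyp_weight_pos[of x] alt_norm_nonneg[OF ml\<alpha>] by (intro mult_nonneg_nonneg) auto
  have "Q \<ge> 0"
    unfolding Q_def using \<open>A \<ge> 0\<close> by simp
  \<comment> \<open>These are exactly the argument sequences that \<open>alternating_shift\<close>
    yields for the frame.\<close>
  have *: "\<bar>?W y\<bar> \<le> fact CARD('n) * (P * Q)" if y: "y = t \<or> (\<exists>b. y = t(b := sgn x))" for y
  proof -
    have norm_y: "norm (y i) \<le> 1" for i
      using y t norm_sgn_le_1[of x] by auto
    have "\<bar>of_int (sign \<sigma>) * \<alpha> (\<lambda>i. y (\<sigma> i)) * covector_wedge l x \<beta> (\<lambda>i. y (\<sigma> (j + i)))\<bar> \<le> P * Q"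
      if \<sigma>: "\<sigma> permutes {..<j + Suc l}" for \<sigma>
    proof (cases "\<forall>i<j. x \<bullet> y (\<sigma> i) = 0")
      case True
      then have "\<bar>\<alpha> (\<lambda>i. y (\<sigma> i))\<bar> \<le> P"
        unfolding P_def using norm_y by (intro tangential_bound[OF ml\<alpha>]) auto
      moreover have "\<bar>covector_wedge l x \<beta> (\<lambda>i. y (\<sigma> (j + i)))\<bar> \<le> Q"
        unfolding Q_def using norm_y by (intro abs_covector_wedge_le bound) auto
      ultimately have "\<bar>\<alpha> (\<lambda>i. y (\<sigma> i))\<bar> * \<bar>covector_wedge l x \<beta> (\<lambda>i. y (\<sigma> (j + i)))\<bar> \<le> P * Q"
        using \<open>P \<ge> 0\<close> by (intro mult_mono) auto
      then show ?thesis
        by (auto simp: abs_mult sign_def)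
    next
      case False
      then obtain i where i: "i < j" "x \<bullet> y (\<sigma> i) \<noteq> 0"
        by blast
      then obtain b where b: "y = t(b := sgn x)" "\<sigma> i = b"
        using y t by (metis fun_upd_other)
      have "\<sigma> (j + m) \<noteq> b" for m
        using b(2) i(1) injD[OF permutes_inj[OF \<sigma>], of "j + m" i] by auto
      then have "x \<bullet> y (\<sigma> (j + m)) = 0" for m
        using b(1) t by simp
      then have "covector_wedge l x \<beta> (\<lambda>i. y (\<sigma> (j + i))) = 0"
        by (simp add: covector_wedge_def)
      then show ?thesis
        using \<open>P \<ge> 0\<close> \<open>Q \<ge> 0\<close> by simp
    qed
    then have "\<bar>\<Sum>\<sigma> | \<sigma> permutes {..<j + Suc l}.
        of_int (sign \<sigma>) * \<alpha> (\<lambda>i. y (\<sigma> i)) * covector_wedge l x \<beta> (\<lambda>i. y (\<sigma> (j + i)))\<bar>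
        \<le> (\<Sum>\<sigma> | \<sigma> permutes {..<j + Suc l}. P * Q)"
      by (intro order.trans[OF sum_abs] sum_mono) auto
    also have "\<dots> = fact CARD('n) * (P * Q)"
      using dim by (simp add: card_permutations del: add_Suc_right)
    finally have "\<bar>?W y\<bar> \<le> fact CARD('n) * (P * Q) / (fact j * fact (Suc l))"
      unfolding wedge_def abs_divide by (simp add: divide_right_mono)
    also have "\<dots> \<le> fact CARD('n) * (P * Q) / 1"
    proof (intro divide_left_mono mult_nonneg_nonneg)
      show "1 \<le> fact j * (fact (Suc l) :: real)"
        by (rule mult_ge1_I) (rule fact_ge_1)+
    qed (use \<open>P \<ge> 0\<close> \<open>Q \<ge> 0\<close> in \<open>auto simp del: fact_Suc\<close>)
    finally show ?thesis by simp
  qed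
  have alt: "alternating CARD('n) ?W"
    using alternating_wedge[OF ml\<alpha> multilinear_covector_wedge[OF ml\<beta>]] dim by simp
  have "?e = (\<lambda>a. c a *\<^sub>R sgn x + t a)"
    by (simp add: c_def t_def tangential_part_def)
  then have "?W ?e = ?W t + (\<Sum>b<CARD('n). c b * ?W (t(b := sgn x)))"
    using alternating_shift[OF alt, of c "sgn x" t] by metis
  moreover have "\<bar>\<Sum>b<CARD('n). c b * ?W (t(b := sgn x))\<bar> \<le> (\<Sum>b<CARD('n). 1 * (fact CARD('n) * (P * Q)))"
  proof (intro order.trans[OF sum_abs] sum_mono)
    fix b
    have "\<bar>c b\<bar> \<le> 1"
      by (simp add: c_def abs_inner_sgn_le)
    moreover have "\<bar>?W (t(b := sgn x))\<bar> \<le> fact CARD('n) * (P * Q)"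
      by (rule *) blast
    ultimately show "\<bar>c b * ?W (t(b := sgn x))\<bar> \<le> 1 * (fact CARD('n) * (P * Q))"
      unfolding abs_mult by (rule mult_mono) auto
  qed
  ultimately have "\<bar>?W ?e\<bar> \<le> (1 + real CARD('n)) * (fact CARD('n) * (P * Q))"
    using *[of t] by (simp add: algebra_simps)
  also have "\<dots> = (1 + real CARD('n)) * fact CARD('n) * (real CARD('n) ^ j * sqrt (fact j)) * ((real l + 1) * A) *
      (norm x * hyp_weight x ^ j * alt_norm (hyperbolic_metric x) j \<alpha>)"
    by (simp only: P_def Q_def mult_ac)
  finally show ?thesis .
qed

subsection \<open>Smooth functions and integration\<close>

lemma Ck_SucI:
  assumes "\<And>x. (f has_derivative D x) (at x)" "\<And>v. Ck m (\<lambda>x. D x v)"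
  shows "Ck (Suc m) f"
proof -
  have "frechet_derivative f (at x) = D x" for x
    using frechet_derivative_at[OF assms(1)] by metis
  then show ?thesis
    using assms by (auto simp: differentiable_def)
qed

lemma Ck_SucD: "Ck (Suc m) f \<Longrightarrow> Ck m f"
proof (induction m arbitrary: f)
  case 0
  then show ?case
    by (auto intro!: continuous_at_imp_continuous_on differentiable_imp_continuous_within)
next
  case (Suc m)
  then show ?case by auto
qed

lemma Ck_has_derivative: "Ck (Suc m) f \<Longrightarrow> (f has_derivative frechet_derivative f (at x)) (at x)"
  by (simp flip: frechet_derivative_works)

lemma Ck_const: "Ck m (\<lambda>x. c)"
  by (induction m arbitrary: c) (auto intro!: Ck_SucI[where D = "\<lambda>_ _. 0"] simp del: Ck.simps(2))

lemma Ck_linear: "bounded_linear f \<Longrightarrow> Ck m f"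
proof (cases m)
  case 0
  assume "bounded_linear f"
  then show ?thesis
    using 0 by (simp add: linear_continuous_on)
next
  case (Suc k)
  assume "bounded_linear f"
  then show ?thesis
    unfolding Suc by (intro Ck_SucI[where D = "\<lambda>_. f"] bounded_linear_imp_has_derivative Ck_const)
qed

lemma Ck_add: "Ck m f \<Longrightarrow> Ck m g \<Longrightarrow> Ck m (\<lambda>x. f x + g x)"
proof (induction m arbitrary: f g)
  case 0
  then show ?case by (auto intro: continuous_on_add)
next
  case (Suc m)
  show ?case
  proof (rule Ck_SucI)
    show "((\<lambda>x. f x + g x) has_derivative
        (\<lambda>v. frechet_derivative f (at x) v + frechet_derivative g (at x) v)) (at x)" for x
      using Suc.prems by (intro has_derivative_add Ck_has_derivative)
    show "Ck m (\<lambda>x. frechet_derivative f (at x) v + frechet_derivative g (at x) v)" for v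
      using Suc.prems by (intro Suc.IH) auto
  qed
qed

lemma Ck_mult: "Ck m f \<Longrightarrow> Ck m g \<Longrightarrow> Ck m (\<lambda>x. f x * g x)"
proof (induction m arbitrary: f g)
  case 0
  then show ?case by (auto intro: continuous_on_mult)
next
  case (Suc m)
  show ?case
  proof (rule Ck_SucI)
    show "((\<lambda>x. f x * g x) has_derivative
        (\<lambda>v. f x * frechet_derivative g (at x) v + frechet_derivative f (at x) v * g x)) (at x)" for x
      using Suc.prems by (intro has_derivative_mult Ck_has_derivative)
    show "Ck m (\<lambda>x. f x * frechet_derivative g (at x) v + frechet_derivative f (at x) v * g x)" for v
      using Suc.prems Ck_SucD by (intro Ck_add Suc.IH) auto
  qed
qed

text \<open>These functions are closed under differentiation, which gives smoothness by induction.\<close>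

definition flat_fun :: "real poly \<Rightarrow> real \<Rightarrow> real" where
  "flat_fun P t = (if t > 0 then poly P (1 / t) * exp (- (1 / t)) else 0)"

text \<open>Chain rule in the variable X = 1/t: each derivative of 1/t contributes X^2 up to sign,
  giving X^2 (P - P').\<close>

definition flat_deriv :: "real poly \<Rightarrow> real poly" where
  "flat_deriv P = [:0, 0, 1:] * (P - pderiv P)"

text \<open>From the right, y = 1/t turns the claim into the decay of a polynomial divided by exp
  y.\<close>

lemma flat_fun_tendsto_0: "(flat_fun P \<longlongrightarrow> 0) (at 0)"
proof (rule filterlim_split_at)
  show "(flat_fun P \<longlongrightarrow> 0) (at_left 0)"
    by (rule tendsto_eventually) (auto simp: flat_fun_def eventually_at_filter)
  have "((\<lambda>y. \<Sum>i\<le>degree P. coeff P i * (y ^ i / exp y)) \<longlongrightarrow> 0) at_top"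
    by (intro tendsto_null_sum tendsto_mult_right_zero tendsto_power_div_exp_0)
  moreover have "(\<lambda>y. \<Sum>i\<le>degree P. coeff P i * (y ^ i / exp y)) = (\<lambda>y. poly P y * exp (- y))"
    by (auto simp: poly_altdef sum_distrib_right exp_minus divide_inverse mult.assoc)
  ultimately have "((\<lambda>y. poly P y * exp (- y)) \<longlongrightarrow> (0::real)) at_top"
    by simp
  from filterlim_compose[OF this filterlim_inverse_at_top_right]
  have "((\<lambda>t. poly P (inverse t) * exp (- inverse t)) \<longlongrightarrow> 0) (at_right 0)" .
  then show "(flat_fun P \<longlongrightarrow> 0) (at_right 0)"
    by (rule Lim_transform_eventually)
      (auto simp: flat_fun_def eventually_at_filter inverse_eq_divide)
qed

lemma flat_fun_has_derivative:
  "(flat_fun P has_real_derivative flat_fun (flat_deriv P) t) (at t)"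
proof -
  consider "t < 0" | "t = 0" | "t > 0" by linarith
  then show ?thesis
  proof cases
    case 1
    have "((\<lambda>_. 0) has_real_derivative flat_fun (flat_deriv P) t) (at t)"
      using 1 by (simp add: flat_fun_def)
    then show ?thesis
      by (rule has_field_derivative_transform_within_open[where S = "{..<0}"])
        (use 1 in \<open>simp_all add: flat_fun_def\<close>)
  next
    case 2
    \<comment> \<open>Dividing by h multiplies the polynomial by X = 1/h, so the difference quotient
      at 0 is again a flat function.\<close>
    have "(\<lambda>h. (flat_fun P (0 + h) - flat_fun P 0) / h) = flat_fun (pCons 0 P)"
      by (auto simp: flat_fun_def fun_eq_iff)
    then show ?thesis
      using flat_fun_tendsto_0[of "pCons 0 P"] 2 by (simp add: DERIV_def flat_fun_def)
  next
    case 3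
    have "((\<lambda>t. poly P (1 / t) * exp (- (1 / t))) has_real_derivative flat_fun (flat_deriv P) t) (at t)"
      using 3 by (auto intro!: derivative_eq_intros DERIV_chain2[OF poly_DERIV]
        simp: flat_fun_def flat_deriv_def field_simps power2_eq_square)
    then show ?thesis
      by (rule has_field_derivative_transform_within_open[where S = "{0<..}"])
        (use 3 in \<open>simp_all add: flat_fun_def\<close>)
  qed
qed

text \<open>The range t \<le> 1 contains every argument 1 - |x|^2/R^2 occurring in
  \<open>bump\<close>, so one constant serves for all R.\<close>

lemma flat_fun_bounded: "\<exists>C\<ge>0. \<forall>t\<le>1. \<bar>flat_fun P t\<bar> \<le> C"
proof -
  have "continuous_on {0..1} (flat_fun P)"
    using flat_fun_has_derivative by (intro continuous_at_imp_continuous_on ballI DERIV_isCont)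
  then have "bounded (flat_fun P ` {0..1})"
    by (intro compact_imp_bounded compact_continuous_image) auto
  then obtain C where C: "\<And>t. t \<in> {0..1} \<Longrightarrow> \<bar>flat_fun P t\<bar> \<le> C"
    unfolding bounded_iff by (auto simp del: atLeastAtMost_iff)
  show ?thesis
  proof (intro exI[of _ "max C 0"] conjI allI impI)
    fix t :: real assume "t \<le> 1"
    then show "\<bar>flat_fun P t\<bar> \<le> max C 0"
      using C[of t] by (cases "t \<ge> 0") (auto simp: flat_fun_def)
  qed simp
qed

text \<open>P = 1 gives the classical bump supported in the ball of radius R; other P describe its
  derivatives. Using the squared norm keeps the function smooth at the origin.\<close>

definition bump :: "real poly \<Rightarrow> real \<Rightarrow> 'a::real_inner \<Rightarrow> real" where
  "bump P R x = flat_fun P (1 - (x \<bullet> x) / R\<^sup>2)"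

lemma bump_has_derivative:
  "(bump P R has_derivative (\<lambda>v. (- 2 / R\<^sup>2 * bump (flat_deriv P) R x) * (x \<bullet> v))) (at x)"
proof -
  have "((\<lambda>x. 1 - c * (x \<bullet> x)) has_derivative (\<lambda>v. - 2 * c * (x \<bullet> v))) (at x)" for c
    by (auto intro!: derivative_eq_intros simp: inner_commute)
  from this[of "1 / R\<^sup>2"]
  have "((\<lambda>x. 1 - (x \<bullet> x) / R\<^sup>2) has_derivative (\<lambda>v. - 2 / R\<^sup>2 * (x \<bullet> v))) (at x)"
    by simp
  from has_derivative_compose[OF this flat_fun_has_derivative[of P, unfolded has_field_derivative_def]]
  show ?thesis
    unfolding bump_def[abs_def] by (simp add: mult_ac)
qed

lemma Ck_bump: "Ck m (bump P R :: real ^ 'n::finite \<Rightarrow> real)"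
proof (induction m arbitrary: P)
  case 0
  show ?case
    using bump_has_derivative
    by (auto intro!: continuous_at_imp_continuous_on has_derivative_continuous)
next
  case (Suc m)
  have "Ck m (\<lambda>x :: real ^ 'n. (- 2 / R\<^sup>2 * bump (flat_deriv P) R x) * (x \<bullet> v))" for v
    by (intro Ck_mult Ck_const Suc Ck_linear bounded_linear_inner_left)
  then show ?case
    by (intro Ck_SucI[OF bump_has_derivative])
qed

lemma bump_eq_0:
  assumes "R > 0" "norm x \<ge> R"
  shows "bump P R x = 0"
proof -
  have "R\<^sup>2 \<le> (norm x)\<^sup>2"
    using assms by (intro power_mono) auto
  then have "1 - (x \<bullet> x) / R\<^sup>2 \<le> 0"
    using assms by (simp add: dot_square_norm)
  then show ?thesis
    by (simp add: bump_def flat_fun_def)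
qed

lemma bump_nonneg: "bump 1 R x \<ge> 0"
  by (simp add: bump_def flat_fun_def)

text \<open>For R \<ge> 1 the argument of the flat function is at least 3/4 on this ball, so the
  bound is uniform in R.\<close>

lemma bump_ge:
  assumes "R \<ge> 1" "norm x \<le> 1 / 2"
  shows "exp (- 2) \<le> bump 1 R x"
proof -
  have "x \<bullet> x \<le> (1 / 2)\<^sup>2"
    unfolding dot_square_norm using assms by (intro power_mono) auto
  moreover have "(x \<bullet> x) / R\<^sup>2 \<le> (x \<bullet> x) / 1"
    using assms by (intro divide_left_mono) (auto simp: one_le_power)
  ultimately have "1 / 2 \<le> 1 - (x \<bullet> x) / R\<^sup>2"
    by (simp add: power2_eq_square)
  moreover have "exp (- 2) \<le> flat_fun 1 y" if "1 / 2 \<le> y" for y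
    using that by (simp add: flat_fun_def field_simps)
  ultimately show ?thesis
    by (simp add: bump_def)
qed

section \<open>Integrals of compactly supported derivatives\<close>

lemma integrable_compact_support:
  fixes f :: "'a::euclidean_space \<Rightarrow> real"
  assumes "continuous_on UNIV f" "compact K" "\<And>x. x \<notin> K \<Longrightarrow> f x = 0"
  shows "integrable lborel f"
proof -
  have "set_integrable lborel K f"
    using assms unfolding set_integrable_def
    by (intro borel_integrable_compact) (auto intro: continuous_on_subset)
  moreover have "(\<lambda>x. indicator K x *\<^sub>R f x) = f"
    using assms(3) by (auto simp: indicator_def fun_eq_iff)
  ultimately show ?thesis
    by (simp add: set_integrable_def)
qed

lemma lborel_integral_translation:
  fixes f :: "'a::euclidean_space \<Rightarrow> real"
  assumes "f \<in> borel_measurable borel"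
  shows "(LINT x|lborel. f (c + x)) = (LINT x|lborel. f x)"
proof -
  have "(LINT x|lborel. f x) = (LINT x|distr lborel borel ((+) c). f x)"
    by (simp add: lborel_distr_plus)
  also have "\<dots> = (LINT x|lborel. f (c + x))"
    using assms by (intro integral_distr) auto
  finally show ?thesis ..
qed

lemma lborel_integrable_translation:
  fixes f :: "'a::euclidean_space \<Rightarrow> real"
  assumes "integrable lborel f"
  shows "integrable lborel (\<lambda>x. f (c + x))"
proof -
  have "integrable (distr lborel borel ((+) c)) f"
    using assms by (simp add: lborel_distr_plus)
  then show ?thesis
    using borel_measurable_integrable[OF assms]
    by (subst (asm) integrable_distr_eq) auto
qed

text \<open>The difference quotients have integral \<open>0\<close> by translation invariance.\<close>

lemma integral_derivative_compact_support:
  fixes f :: "'a::euclidean_space \<Rightarrow> real"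
  assumes der: "\<And>x. (f has_derivative D x) (at x)"
    and cont: "continuous_on UNIV (\<lambda>x. D x v)"
    and K: "compact K" "\<And>x. x \<notin> K \<Longrightarrow> f x = 0"
  shows "integrable lborel (\<lambda>x. D x v)" "(LINT x|lborel. D x v) = 0"
proof -
  have D0: "D x v = 0" if "x \<notin> K" for x
  proof -
    have "((\<lambda>_. 0) has_derivative D x) (at x)"
      using K that der[of x] compact_imp_closed[OF K(1)]
      by (intro has_derivative_transform_within_open[OF der, of "- K"]) auto
    then have "D x = (\<lambda>_. 0)"
      using has_derivative_const has_derivative_unique by blast
    then show ?thesis by simp
  qed
  show "integrable lborel (\<lambda>x. D x v)"
    using integrable_compact_support[OF cont K(1)] D0 by blast
  have cont_f: "continuous_on UNIV f"
    using der by (auto intro!: continuous_at_imp_continuous_on has_derivative_continuous)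
  have int_f: "integrable lborel f"
    using integrable_compact_support[OF cont_f K(1)] K(2) by blast
  have [measurable]: "f \<in> borel_measurable borel" "(\<lambda>x. D x v) \<in> borel_measurable borel"
    using cont cont_f by (auto intro: borel_measurable_continuous_onI)
  obtain B where B: "\<And>x. x \<in> K \<Longrightarrow> norm x \<le> B"
    using compact_imp_bounded[OF K(1)] unfolding bounded_iff by blast
  have "bounded ((\<lambda>x. D x v) ` K)"
    using K(1) cont by (intro compact_imp_bounded compact_continuous_image) (auto intro: continuous_on_subset)
  then obtain M0 where M0: "\<And>x. x \<in> K \<Longrightarrow> \<bar>D x v\<bar> \<le> M0"
    unfolding bounded_iff by auto
  \<comment> \<open>K may be empty, in which case \<open>M0\<close> could be negative.\<close>
  define M where "M = max M0 0"
  have M: "\<bar>D x v\<bar> \<le> M" for x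
    using M0[of x] D0[of x] by (cases "x \<in> K") (auto simp: M_def)
  have M_nonneg: "M \<ge> 0"
    by (simp add: M_def)
  define t where "t i = 1 / real (Suc i)" for i
  have t: "t i > 0" "t i \<le> 1" for i
    by (auto simp: t_def)
  define F where "F i x = (f (t i *\<^sub>R v + x) - f x) / t i" for i x
  have lim: "(\<lambda>i. F i x) \<longlonglongrightarrow> D x v" for x
  proof -
    have "((\<lambda>s. x + s *\<^sub>R v) has_vector_derivative v) (at 0)"
      by (auto intro!: derivative_eq_intros)
    then have "((\<lambda>s. f (x + s *\<^sub>R v)) has_derivative (\<lambda>s. D x (s *\<^sub>R v))) (at 0)"
      unfolding has_vector_derivative_def
      using has_derivative_compose[of "\<lambda>s. x + s *\<^sub>R v" "\<lambda>s. s *\<^sub>R v" 0 UNIV f "D x"] der[of x]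
      by simp
    moreover have "(\<lambda>s. D x (s *\<^sub>R v)) = (*) (D x v)"
      using linear_cmul[OF has_derivative_linear[OF der[of x]]] by (auto simp: mult.commute)
    ultimately have "((\<lambda>s. f (x + s *\<^sub>R v)) has_real_derivative D x v) (at 0)"
      by (simp add: has_field_derivative_def)
    then have lim0: "((\<lambda>h. (f (x + h *\<^sub>R v) - f x) / h) \<longlongrightarrow> D x v) (at 0)"
      by (simp add: DERIV_def)
    have "filterlim t (at 0) sequentially"
      unfolding filterlim_at using t LIMSEQ_Suc[OF lim_1_over_n[where 'a=real]] 
      by (auto simp: t_def[abs_def] intro!: always_eventually)
    from filterlim_compose[OF lim0 this] show ?thesis
      by (simp add: F_def add.commute)
  qed
  \<comment> \<open>The mean value theorem gives the bound M. As the step \<open>t i\<close> is at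
    most 1, both points of the quotient lie outside K once norm x exceeds B + norm v.\<close>
  have bound: "\<bar>F i x\<bar> \<le> M * indicator (cball 0 (B + norm v)) x" for i x
  proof (cases "norm x \<le> B + norm v")
    case True
    have "\<exists>s>0. s < t i \<and> f (x + t i *\<^sub>R v) - f (x + 0 *\<^sub>R v) = (t i - 0) * D (x + s *\<^sub>R v) v"
    proof (rule MVT2)
      fix s assume "0 \<le> s" "s \<le> t i"
      have "((\<lambda>s. x + s *\<^sub>R v) has_derivative (\<lambda>s. s *\<^sub>R v)) (at s)"
        by (auto intro!: derivative_eq_intros)
      from has_derivative_compose[OF this der]
      have "((\<lambda>s. f (x + s *\<^sub>R v)) has_derivative (\<lambda>h. D (x + s *\<^sub>R v) (h *\<^sub>R v))) (at s)" .
      moreover have "(\<lambda>h. D (x + s *\<^sub>R v) (h *\<^sub>R v)) = (*) (D (x + s *\<^sub>R v) v)"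
        using linear_cmul[OF has_derivative_linear[OF der[of "x + s *\<^sub>R v"]]] by (auto simp: mult.commute)
      ultimately show "((\<lambda>s. f (x + s *\<^sub>R v)) has_real_derivative D (x + s *\<^sub>R v) v) (at s)"
        by (simp add: has_field_derivative_def)
    qed (use t in simp)
    then obtain s where "f (x + t i *\<^sub>R v) - f x = t i * D (x + s *\<^sub>R v) v"
      by auto
    then have "F i x = D (x + s *\<^sub>R v) v"
      using t[of i] by (simp add: F_def add.commute)
    then show ?thesis
      using M True by (simp add: indicator_def)
  next
    case False
    have "norm x \<le> norm (t i *\<^sub>R v + x) + norm (t i *\<^sub>R v)"
      using norm_triangle_sub[of x "- (t i *\<^sub>R v)"] by (simp add: add.commute)
    moreover have "norm (t i *\<^sub>R v) \<le> norm v"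
      using t[of i] by (simp add: mult_left_le_one_le)
    ultimately have "x \<notin> K" "t i *\<^sub>R v + x \<notin> K"
      using False B[of x] B[of "t i *\<^sub>R v + x"] norm_ge_zero[of v] by auto
    then show ?thesis
      using K(2) M_nonneg by (simp add: F_def)
  qed
  have "(\<lambda>i. LINT x|lborel. F i x) \<longlonglongrightarrow> (LINT x|lborel. D x v)"
  proof (rule integral_dominated_convergence[where w = "\<lambda>x. M * indicator (cball 0 (B + norm v)) x"])
    show "integrable lborel (\<lambda>x. M * indicator (cball 0 (B + norm v)) x :: real)"
      by (intro integrable_mult_right integrable_real_indicator)
        (auto intro: emeasure_bounded_finite[unfolded infinity_ennreal_def])
    show "F i \<in> borel_measurable lborel" for i
      unfolding F_def by measurable
  qed (use lim bound in auto)
  moreover have "(LINT x|lborel. F i x) = 0" for i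
    unfolding F_def using int_f lborel_integrable_translation[OF int_f]
    by (simp add: lborel_integral_translation)
  ultimately show "(LINT x|lborel. D x v) = 0"
    using LIMSEQ_unique tendsto_const by simp blast
qed

section \<open>Integrability of powers of the weight\<close>

lemma integrable_exp_neg_norm:
  fixes d :: real
  assumes "d > 0"
  shows "integrable lborel (\<lambda>x :: 'a::euclidean_space. exp (- d * norm x))"
proof (rule integrableI_bounded)
  define n where "n = DIM('a)"
  have "n > 0" by (simp add: n_def)
  define V where "V = unit_ball_vol (real n)"
  have "V \<ge> 0" by (simp add: V_def)
  \<comment> \<open>On the shell where the integer part of norm x is j, the j-th summand alone
    dominates.\<close>
  have ptw: "ennreal (exp (- d * norm x)) \<le>
      (\<Sum>j. ennreal (exp (- d * real j)) * indicator (ball 0 (real (Suc j))) x)" for x :: 'a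
  proof -
    define j where "j = nat \<lfloor>norm x\<rfloor>"
    have j: "real j \<le> norm x" "norm x < real (Suc j)"
      by (auto simp: j_def) linarith
    then have "ennreal (exp (- d * norm x)) \<le> ennreal (exp (- d * real j)) * indicator (ball 0 (real (Suc j))) x"
      using assms by (simp add: ennreal_leI)
    also have "\<dots> \<le> (\<Sum>j. ennreal (exp (- d * real j)) * indicator (ball 0 (real (Suc j))) x)"
      by (rule order.trans[OF _ sum_le_suminf[OF summableI, of "{j}"]]) (simp_all only: finite.intros sum.insert sum.empty empty_iff not_False_eq_True add_0_right order_refl zero_le)
    finally show ?thesis .
  qed
  define c where "c = (2 * real n / d) ^ n * V * exp (d / 2)"
  have summand: "exp (- d * real j) * (V * real (Suc j) ^ n) \<le> c * exp (- (d / 2)) ^ j" for j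
  proof -
    \<comment> \<open>Chosen so that n y = d (j+1) / 2: then y^n \<le> exp (n y) pays for the volume
      growth with half of the exponential decay, and a geometric series remains.\<close>
    define y where "y = d / (2 * real n) * real (Suc j)"
    have "y \<ge> 0" using assms by (simp add: y_def)
    have "real (Suc j) ^ n = (2 * real n / d) ^ n * y ^ n"
      using assms \<open>n > 0\<close> by (simp add: y_def flip: power_mult_distrib)
    also have "y ^ n \<le> exp y ^ n"
      using exp_ge_add_one_self[of y] \<open>y \<ge> 0\<close> by (intro power_mono) linarith+
    also have "exp y ^ n = exp (d / 2 * real (Suc j))"
      using \<open>n > 0\<close> by (simp add: y_def flip: exp_of_nat_mult)
    finally have "real (Suc j) ^ n \<le> (2 * real n / d) ^ n * exp (d / 2 * real (Suc j))"
      using assms by (simp add: mult_left_mono)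
    then have "exp (- d * real j) * (V * real (Suc j) ^ n)
        \<le> exp (- d * real j) * (V * ((2 * real n / d) ^ n * exp (d / 2 * real (Suc j))))"
      using \<open>V \<ge> 0\<close> by (intro mult_left_mono) auto
    also have "\<dots> = (2 * real n / d) ^ n * V * (exp (- d * real j) * exp (d / 2 * real (Suc j)))"
      by (simp only: mult_ac)
    also have "exp (- d * real j) * exp (d / 2 * real (Suc j)) = exp (d / 2) * exp (- (d / 2)) ^ j"
    proof -
      have "- d * real j + d / 2 * real (Suc j) = d / 2 + real j * (- (d / 2))"
        by (simp add: field_simps)
      then show ?thesis
        by (simp only: exp_add[symmetric] exp_of_nat_mult[symmetric])
    qed
    finally show ?thesis
      by (simp add: c_def)
  qed
  have "c \<ge> 0"
    using assms \<open>V \<ge> 0\<close> by (simp add: c_def)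
  have "(\<integral>\<^sup>+ x. ennreal (norm (exp (- d * norm (x :: 'a)))) \<partial>lborel)
      \<le> (\<integral>\<^sup>+ x. (\<Sum>j. ennreal (exp (- d * real j)) * indicator (ball (0 :: 'a) (real (Suc j))) x) \<partial>lborel)"
    using ptw by (intro nn_integral_mono) simp
  also have "\<dots> = (\<Sum>j. ennreal (exp (- d * real j)) * emeasure lborel (ball (0 :: 'a) (real (Suc j))))"
    by (subst nn_integral_suminf)
      (auto simp: nn_integral_cmult_indicator simp del: of_nat_Suc
        intro!: borel_measurable_times_ennreal borel_measurable_indicator)
  also have "\<dots> = (\<Sum>j. ennreal (exp (- d * real j) * (V * real (Suc j) ^ n)))"
    using \<open>V \<ge> 0\<close> by (simp add: emeasure_ball V_def n_def ennreal_mult del: of_nat_Suc)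
  also have "\<dots> \<le> (\<Sum>j. ennreal (c * exp (- (d / 2)) ^ j))"
    using summand by (intro suminf_le ennreal_leI) auto
  also have "\<dots> < \<infinity>"
  proof -
    have "summable (\<lambda>j. c * exp (- (d / 2)) ^ j)"
      using assms by (intro summable_mult summable_geometric) simp
    then show ?thesis
      using \<open>c \<ge> 0\<close> by (subst suminf_ennreal2) auto
  qed
  finally show "(\<integral>\<^sup>+ x. ennreal (norm (exp (- d * norm (x :: 'a)))) \<partial>lborel) < \<infinity>" .
qed simp

text \<open>Arbitrarily small e is allowed thanks to the exponential lower bound on the weight; the
  strict inequalities for q and p serve to make e positive.\<close>

lemma integrable_hyp_weight_powr:
  assumes "e > 0"
  shows "integrable lborel (\<lambda>x :: real ^ 'n::finite. hyp_weight x powr (- e))"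
proof (rule Bochner_Integration.integrable_bound)
  show "integrable lborel (\<lambda>x :: real ^ 'n. 2 powr e * exp (- (e / 2) * norm x))"
    using assms by (intro integrable_mult_right integrable_exp_neg_norm) auto
  show "AE x :: real ^ 'n in lborel. norm (hyp_weight x powr (- e)) \<le> norm (2 powr e * exp (- (e / 2) * norm x))"
  proof (rule AE_I2)
    fix x :: "real ^ 'n"
    have "hyp_weight x powr (- e) \<le> (exp (norm x / 2) / 2) powr (- e)"
      using hyp_weight_ge_exp[of x] assms by (intro powr_mono2') auto
    also have "\<dots> = 2 powr e * exp (- (e / 2) * norm x)"
      by (simp add: powr_divide powr_minus_divide exp_powr_real exp_minus field_simps flip: exp_add)
    finally show "norm (hyp_weight x powr (- e)) \<le> norm (2 powr e * exp (- (e / 2) * norm x))"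
      by simp
  qed
qed simp

text \<open>This replaces Hoelder's inequality: if \<open>f\<close> is larger than a suitable power of \<open>w\<close>, then the
  first summand dominates, otherwise the second one does.\<close>

lemma weighted_power_bound:
  fixes f w q a b :: real
  assumes "f \<ge> 0" "w \<ge> 1" "q > 1"
  shows "f * w powr a \<le> f powr q * w powr b + w powr (- ((b - q * a) / (q - 1)))"
proof (cases "f = 0")
  case False
  then have "f > 0" using assms by simp
  show ?thesis
  \<comment> \<open>The threshold at which f w^a and f^q w^b agree.\<close>
  proof (cases "f powr (q - 1) \<ge> w powr (a - b)")
    case True
    have "f * w powr a = f * (w powr (a - b) * w powr b)"
      using assms by (simp flip: powr_add)
    also have "\<dots> \<le> f * (f powr (q - 1) * w powr b)"
      using True assms by (intro mult_left_mono mult_right_mono) auto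
    also have "\<dots> = f powr q * w powr b"
      using \<open>f > 0\<close> by (simp add: powr_diff)
    finally show ?thesis
      by (simp add: add_increasing2)
  next
    case False
    have "f = (f powr (q - 1)) powr (1 / (q - 1))"
      using \<open>f > 0\<close> assms by (simp add: powr_powr)
    also have "\<dots> \<le> (w powr (a - b)) powr (1 / (q - 1))"
      using False assms by (intro powr_mono2) auto
    finally have "f * w powr a \<le> w powr ((a - b) / (q - 1)) * w powr a"
      by (intro mult_right_mono) (simp_all add: powr_powr)
    also have "\<dots> = w powr (- ((b - q * a) / (q - 1)))"
    proof -
      have "(a - b) / (q - 1) + a = - ((b - q * a) / (q - 1))"
        using assms by (simp add: divide_simps) (simp add: algebra_simps)
      then show ?thesis
        by (simp flip: powr_add)
    qed
    finally show ?thesis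
      by (simp add: add_increasing)
  qed
qed simp

text \<open>For q > 1 the pointwise bound with a = j and b = m leaves the remainder w^(-e), where e
  = (m - q j)/(q - 1) > 0. For q = 1 there is no such exponent, but j \<le> m and w \<ge> 1 compare
  the weights directly.\<close>

lemma integrable_weighted_Lq:
  fixes f :: "real ^ 'n::finite \<Rightarrow> real"
  assumes f: "f \<in> borel_measurable borel" "\<And>x. f x \<ge> 0"
    and int: "integrable lborel (\<lambda>x. hyp_weight x ^ m * f x powr q)"
    and q: "q \<ge> 1" "q * real j < real m"
  shows "integrable lborel (\<lambda>x. f x * hyp_weight x ^ j)"
proof -
  note [measurable] = f(1)
  have pow: "hyp_weight x ^ i = hyp_weight x powr real i" for x :: "real ^ 'n" and i
    using hyp_weight_pos[of x] by (simp add: powr_realpow)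
  show ?thesis
  proof (cases "q = 1")
    case True
    then have "j \<le> m" using q by simp
    have "integrable lborel (\<lambda>x. hyp_weight x ^ m * f x)"
      using int f(2) True by simp
    then show ?thesis
    proof (rule Bochner_Integration.integrable_bound)
      show "AE x in lborel. norm (f x * hyp_weight x ^ j) \<le> norm (hyp_weight x ^ m * f x)"
      proof (rule AE_I2)
        fix x
        have "f x * hyp_weight x ^ j \<le> f x * hyp_weight x ^ m"
          using f(2) \<open>j \<le> m\<close> hyp_weight_ge_1[of x] by (intro mult_left_mono power_increasing)
        then show "norm (f x * hyp_weight x ^ j) \<le> norm (hyp_weight x ^ m * f x)"
          using f(2)[of x] hyp_weight_pos[of x] by (simp add: abs_mult mult.commute)
      qed
    qed simp
  next
    case False
    define e where "e = (real m - q * real j) / (q - 1)"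
    have "q > 1" "e > 0"
      using False q by (auto simp: e_def)
    have "integrable lborel (\<lambda>x. hyp_weight x ^ m * f x powr q + hyp_weight x powr (- e))"
      by (intro Bochner_Integration.integrable_add int integrable_hyp_weight_powr \<open>e > 0\<close>)
    then show ?thesis
    proof (rule Bochner_Integration.integrable_bound)
      show "AE x in lborel. norm (f x * hyp_weight x ^ j)
          \<le> norm (hyp_weight x ^ m * f x powr q + hyp_weight x powr (- e))"
      proof (rule AE_I2)
        fix x
        have "f x * hyp_weight x ^ j \<le> hyp_weight x ^ m * f x powr q + hyp_weight x powr (- e)"
          using weighted_power_bound[OF f(2)[of x] hyp_weight_ge_1[of x] \<open>q > 1\<close>, of "real j" "real m"]
          by (simp add: e_def pow mult.commute)
        then show "norm (f x * hyp_weight x ^ j)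
            \<le> norm (hyp_weight x ^ m * f x powr q + hyp_weight x powr (- e))"
          using f(2)[of x] hyp_weight_pos[of x] by (simp add: abs_mult)
      qed
    qed simp
  qed
qed

subsection \<open>The constant form and the test forms\<close>

lemma wedge_scale_left: "wedge k l (\<lambda>v. c * \<alpha> v) \<beta> v = c * wedge k l \<alpha> \<beta> v"
  by (simp add: wedge_def sum_distrib_left mult_ac)

lemma wedge_scale_right: "wedge k l \<alpha> (\<lambda>v. c * \<beta> v) v = c * wedge k l \<alpha> \<beta> v"
  by (simp add: wedge_def sum_distrib_left mult_ac)

lemma ext_deriv_eq_skip_arg:
  "ext_deriv k \<omega> x v =
     (\<Sum>i\<le>k. (-1) ^ i * frechet_derivative (\<lambda>y. \<omega> y (skip_arg i v)) (at x) (v i))"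
  by (simp add: ext_deriv_def skip_arg_def)

lemma has_bochner_integral_ext_deriv:
  fixes \<omega> :: "'n::finite dform"
  assumes "test_form l \<omega>"
  shows "has_bochner_integral lborel (\<lambda>x. ext_deriv l \<omega> x v) 0"
proof -
  obtain K where K: "compact K" "\<And>x. x \<notin> K \<Longrightarrow> \<omega> x = (\<lambda>v. 0)"
    using assms by (auto simp: test_form_def)
  have "has_bochner_integral lborel (\<lambda>x. frechet_derivative (\<lambda>y. \<omega> y w) (at x) u) 0" for w u
  proof -
    have "smooth (\<lambda>y. \<omega> y w)"
      using assms by (simp add: test_form_def)
    then have Ck: "Ck (Suc 0) (\<lambda>y. \<omega> y w)"
      unfolding smooth_def by blast
    then have "continuous_on UNIV (\<lambda>x. frechet_derivative (\<lambda>y. \<omega> y w) (at x) u)"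
      by simp
    from integral_derivative_compact_support[OF Ck_has_derivative[OF Ck] this K(1)] K(2)
    show ?thesis
      by (simp add: has_bochner_integral_iff)
  qed
  then have "has_bochner_integral lborel (\<lambda>x. ext_deriv l \<omega> x v) (\<Sum>i\<le>l. (-1) ^ i * 0)"
    unfolding ext_deriv_eq_skip_arg
    by (intro has_bochner_integral_sum has_bochner_integral_mult_right)
  then show ?thesis by simp
qed

text \<open>With \<alpha> constant, the integrand is a fixed linear combination of components of
  d\<omega>, each of which has integral 0.\<close>

lemma weak_deriv_const: "weak_deriv k (\<lambda>x. \<alpha>) (\<lambda>x v. 0)"
  unfolding weak_deriv_def
proof (intro allI impI)
  fix l and \<omega> :: "'a dform"
  assume "Suc k + l = CARD('a) \<and> test_form l \<omega>"
  then have "has_bochner_integral lborel (\<lambda>x. wedge k (Suc l) \<alpha> (ext_deriv l \<omega> x) std_frame)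
      ((\<Sum>\<sigma> | \<sigma> permutes {..<k + Suc l}.
        of_int (sign \<sigma>) * \<alpha> (\<lambda>i. std_frame (\<sigma> i)) * 0) / (fact k * fact (Suc l)))"
    unfolding wedge_def
    by (intro has_bochner_integral_divide_zero has_bochner_integral_sum has_bochner_integral_mult_right
        has_bochner_integral_ext_deriv) auto
  then have "integral_form (\<lambda>x. wedge k (Suc l) \<alpha> (ext_deriv l \<omega> x)) = 0"
    by (simp add: integral_form_def has_bochner_integral_iff)
  moreover have "wedge (Suc k) l (\<lambda>v. 0) \<beta> = (\<lambda>v. 0)" for \<beta> :: "'a alt"
    by (simp add: wedge_def fun_eq_iff)
  ultimately show "integral_form (\<lambda>x. wedge (Suc k) l (\<lambda>v. 0) (\<omega> x)) =
      (-1) ^ Suc k * integral_form (\<lambda>x. wedge k (Suc l) \<alpha> (ext_deriv l \<omega> x))"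
    by (simp add: integral_form_def)
qed

lemma test_form_bump:
  fixes \<beta> :: "'n::finite alt"
  assumes "alternating l \<beta>" "R > 0"
  shows "test_form l (\<lambda>x v. bump P R x * \<beta> v)"
  unfolding test_form_def
proof (intro conjI allI)
  show "alternating l (\<lambda>v. bump P R x * \<beta> v)" for x
    by (rule alternating_scale[OF assms(1)])
  show "smooth (\<lambda>x. bump P R x * \<beta> v)" for v
    unfolding smooth_def by (intro allI Ck_mult Ck_bump Ck_const)
  show "\<exists>K. compact K \<and> (\<forall>x :: real ^ 'n. x \<notin> K \<longrightarrow> (\<lambda>v. bump P R x * \<beta> v) = (\<lambda>v. 0))"
  proof (intro exI[of _ "cball 0 R"] conjI allI impI)
    show "(\<lambda>v. bump P R x * \<beta> v) = (\<lambda>v. 0)" if "x \<notin> cball 0 R" for x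
      using that bump_eq_0[OF \<open>R > 0\<close>, of x P] by (auto simp: not_le)
  qed (rule compact_cball)
qed

text \<open>Only the bump is differentiated. Its gradient is a multiple of x, and this is how the
  factor dr enters the test.\<close>

lemma ext_deriv_bump:
  "ext_deriv l (\<lambda>x v. bump P R x * \<beta> v) x =
     (\<lambda>v. (- 2 / R\<^sup>2 * bump (flat_deriv P) R x) * covector_wedge l x \<beta> v)"
proof
  fix v :: "nat \<Rightarrow> real ^ 'a"
  define c where "c = - 2 / R\<^sup>2 * bump (flat_deriv P) R x"
  have deriv: "frechet_derivative (\<lambda>y. bump P R y * b) (at x) = (\<lambda>u. c * (x \<bullet> u) * b)" for b :: real
    using frechet_derivative_at[OF has_derivative_mult_left[OF bump_has_derivative]]
    unfolding c_def by metis
  have "ext_deriv l (\<lambda>x v. bump P R x * \<beta> v) x v = c * covector_wedge l x \<beta> v"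
    unfolding ext_deriv_eq_skip_arg covector_wedge_def sum_distrib_left
    by (intro sum.cong refl) (simp only: deriv, simp only: mult_ac)
  then show "ext_deriv l (\<lambda>x v. bump P R x * \<beta> v) x v =
      (- 2 / R\<^sup>2 * bump (flat_deriv P) R x) * covector_wedge l x \<beta> v"
    by (simp only: c_def)
qed

lemma sets_riem_volume [simp, measurable_cong]: "sets (riem_volume g) = sets borel"
  by (simp add: riem_volume_def)

lemma integrable_riem_volume_hyperbolic:
  fixes f :: "real ^ 'n::finite \<Rightarrow> real"
  assumes "f \<in> borel_measurable borel"
  shows "integrable (riem_volume hyperbolic_metric) f \<longleftrightarrow>
    integrable lborel (\<lambda>x. hyp_weight x ^ (CARD('n) - 1) * f x)"
  unfolding riem_volume_def sqrt_det_hyperbolic_metric using assms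
  by (subst integrable_density) (auto simp: hyp_weight_pos less_imp_le intro!: AE_I2)

text \<open>A non-integrable f has integral 0 by convention, while g \<ge> 0. The pairing with
  \<phi> can thus be bounded without a separate measurability proof.\<close>

lemma abs_integral_le:
  fixes f g :: "'a \<Rightarrow> real"
  assumes "integrable M g" "\<And>x. \<bar>f x\<bar> \<le> g x"
  shows "\<bar>integral\<^sup>L M f\<bar> \<le> integral\<^sup>L M g"
proof (cases "integrable M f")
  case True
  then show ?thesis
    using assms by (intro order.trans[OF integral_abs_bound] integral_mono) auto
next
  case False
  have "g x \<ge> 0" for x
    using assms(2)[of x] by linarith
  then show ?thesis
    using False by (simp add: not_integrable_integral_eq)
qed

text \<open>The integral grows like R^n, but a positive bound independent of R is enough.\<close>

lemma bump_integral_ge: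
  assumes "R \<ge> 1"
  shows "exp (- 2) * measure lborel (cball (0 :: 'a::euclidean_space) (1 / 2))
    \<le> (LINT x|lborel. bump 1 R (x :: 'a))"
proof -
  have cont: "continuous_on UNIV (bump 1 R :: 'a \<Rightarrow> real)"
    by (auto intro!: continuous_at_imp_continuous_on has_derivative_continuous bump_has_derivative)
  have int: "integrable lborel (bump 1 R :: 'a \<Rightarrow> real)"
    using assms by (intro integrable_compact_support[OF cont compact_cball[of 0 R]] bump_eq_0) auto
  have fin: "emeasure lborel (cball (0 :: 'a) (1 / 2)) < \<infinity>"
    by (intro emeasure_bounded_finite) simp
  have "exp (- 2) * measure lborel (cball (0 :: 'a) (1 / 2))
      = (LINT x|lborel. exp (- 2) * indicator (cball (0 :: 'a) (1 / 2)) x)"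
    by simp
  also have "\<dots> \<le> (LINT x|lborel. bump 1 R (x :: 'a))"
  proof (intro integral_mono int)
    show "integrable lborel (\<lambda>x. exp (- 2) * indicator (cball (0 :: 'a) (1 / 2)) x :: real)"
      using fin by (intro integrable_mult_right integrable_real_indicator) auto
    show "exp (- 2) * indicator (cball 0 (1 / 2)) x \<le> bump 1 R x" for x :: 'a
      using bump_ge[OF assms, of x] bump_nonneg[of R x] by (auto simp: indicator_def)
  qed
  finally show ?thesis .
qed

section \<open>The obstruction to exactness\<close>

lemma head_form_not_exact:
  fixes \<phi> :: "'n::finite dform"
  assumes dim: "Suc j + l = CARD('n)"
    and \<phi>: "\<phi> \<in> Lp_forms hyperbolic_metric (ereal q) j"
    and q: "1 \<le> q" "q * real j < real (CARD('n) - 1)"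
  shows "\<not> weak_deriv j \<phi> (\<lambda>x v. - head_form (Suc j) v)"
proof
  assume weak: "weak_deriv j \<phi> (\<lambda>x v. - head_form (Suc j) v)"
  let ?\<psi> = "tail_form (Suc j) :: 'n alt"
  have ml\<phi>: "multilinear_form j (\<phi> x)" for x
    using \<phi> by (auto simp: Lp_forms_def loc_integrable_form_def intro: alternating_multilinear)
  have alt\<psi>: "alternating l ?\<psi>"
    using dim by (rule alternating_tail_form)
  define f where "f x = alt_norm (hyperbolic_metric x) j (\<phi> x)" for x
  have f: "f x \<ge> 0" for x
    by (simp add: f_def alt_norm_nonneg[OF ml\<phi>])
  have f_Lq: "in_Lp (riem_volume hyperbolic_metric) (ereal q) f"
    using \<phi> by (simp add: Lp_forms_def f_def[abs_def])
  then have [measurable]: "f \<in> borel_measurable borel"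
    by (simp add: in_Lp_def cong: measurable_cong_sets)
  have "integrable lborel (\<lambda>x. hyp_weight x ^ (CARD('n) - 1) * f x powr q)"
    using f_Lq f by (simp add: in_Lp_def integrable_riem_volume_hyperbolic)
  \<comment> \<open>The volume density supplies w^(n-1) in the \<open>L^q\<close> norm; w^j is the
    price of evaluating \<phi> on j tangential vectors of Euclidean length at most 1.\<close>
  then have int: "integrable lborel (\<lambda>x. f x * hyp_weight x ^ j)"
    using q f by (intro integrable_weighted_Lq[of f "CARD('n) - 1" q]) auto
  obtain C1 where C1: "C1 \<ge> 0" "\<And>t. t \<le> 1 \<Longrightarrow> \<bar>flat_fun (flat_deriv 1) t\<bar> \<le> C1"
    using flat_fun_bounded by blast
  \<comment> \<open>The constant of \<open>wedge_covector_bound\<close> with A = n!, the bound for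
    \<open>tail_form\<close>; it does not involve R.\<close>
  define C2 where "C2 = (1 + real CARD('n)) * fact CARD('n) * (real CARD('n) ^ j * sqrt (fact j)) *
    ((real l + 1) * fact CARD('n))"
  have C2: "\<bar>wedge j (Suc l) (\<phi> x) (covector_wedge l x ?\<psi>) std_frame\<bar> \<le> C2 * (norm x * hyp_weight x ^ j * f x)" for x
    unfolding C2_def f_def using dim alt\<psi>
    by (intro wedge_covector_bound ml\<phi> alternating_multilinear abs_tail_form_le) auto
  have "C2 \<ge> 0"
    by (simp add: C2_def)
  define c where "c = wedge (Suc j) l (head_form (Suc j)) ?\<psi> std_frame"
  have "c > 0"
    unfolding c_def using dim by (rule wedge_head_tail_pos)
  define m where "m = exp (- 2) * measure lborel (cball (0 :: real ^ 'n) (1 / 2))"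
  have "m > 0"
    by (simp add: m_def content_cball)
  define I where "I = (LINT x|lborel. f x * hyp_weight x ^ j)"
  have main: "c * m \<le> 2 * C1 * C2 / R * I" if "R \<ge> 1" for R
  proof -
    define \<omega> :: "'n dform" where "\<omega> = (\<lambda>x v. bump 1 R x * ?\<psi> v)"
    have "test_form l \<omega>"
      unfolding \<omega>_def using alt\<psi> that by (intro test_form_bump) auto
    then have eq: "integral_form (\<lambda>x. wedge (Suc j) l (\<lambda>v. - head_form (Suc j) v) (\<omega> x)) =
        (-1) ^ Suc j * integral_form (\<lambda>x. wedge j (Suc l) (\<phi> x) (ext_deriv l \<omega> x))"
      using weak dim unfolding weak_deriv_def by blast
    have "wedge (Suc j) l (\<lambda>v. - head_form (Suc j) v) (\<omega> x) std_frame = - c * bump 1 R x" for x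
      using wedge_scale_left[of "Suc j" l "-1" "head_form (Suc j)" "\<omega> x" std_frame]
      by (simp add: \<omega>_def wedge_scale_right c_def)
    then have "\<bar>integral_form (\<lambda>x. wedge (Suc j) l (\<lambda>v. - head_form (Suc j) v) (\<omega> x))\<bar>
        = c * \<bar>LINT x|lborel. bump 1 R (x :: real ^ 'n)\<bar>"
      using \<open>c > 0\<close> by (simp add: integral_form_def abs_mult)
    moreover have "m \<le> \<bar>LINT x|lborel. bump 1 R (x :: real ^ 'n)\<bar>"
      using bump_integral_ge[OF that, where 'a="real ^ 'n"] unfolding m_def by linarith
    ultimately have "c * m \<le> \<bar>integral_form (\<lambda>x. wedge (Suc j) l (\<lambda>v. - head_form (Suc j) v) (\<omega> x))\<bar>"
      using \<open>c > 0\<close> by simp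
    also have "\<dots> = \<bar>integral_form (\<lambda>x. wedge j (Suc l) (\<phi> x) (ext_deriv l \<omega> x))\<bar>"
      by (simp add: eq abs_mult power_abs)
    also have "\<dots> \<le> (LINT x|lborel. 2 * C1 * C2 / R * (f x * hyp_weight x ^ j))"
      unfolding integral_form_def
    proof (rule abs_integral_le)
      show "integrable lborel (\<lambda>x. 2 * C1 * C2 / R * (f x * hyp_weight x ^ j))"
        by (intro integrable_mult_right int)
      fix x :: "real ^ 'n"
      let ?b = "bump (flat_deriv 1) R x"
      have fw: "0 \<le> hyp_weight x ^ j * f x"
        using f hyp_weight_pos[of x] by simp
      \<comment> \<open>Outside the ball of radius R the bump vanishes, inside norm x < R. Against
        the prefactor 2/R^2 this leaves the decay 2/R.\<close>
      have b: "\<bar>?b\<bar> * norm x \<le> C1 * R"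
      proof (cases "norm x \<ge> R")
        case True
        then show ?thesis
          using that C1(1) by (simp add: bump_eq_0)
      next
        case False
        have "\<bar>?b\<bar> \<le> C1"
          unfolding bump_def by (rule C1(2)) simp
        then show ?thesis
          using False C1(1) by (intro mult_mono) auto
      qed
      have "\<bar>wedge j (Suc l) (\<phi> x) (ext_deriv l \<omega> x) std_frame\<bar>
          = 2 / R\<^sup>2 * \<bar>?b\<bar> * \<bar>wedge j (Suc l) (\<phi> x) (covector_wedge l x ?\<psi>) std_frame\<bar>"
        unfolding \<omega>_def ext_deriv_bump wedge_scale_right by (simp add: abs_mult)
      also have "\<dots> \<le> 2 / R\<^sup>2 * \<bar>?b\<bar> * (C2 * (norm x * hyp_weight x ^ j * f x))"
        by (intro mult_left_mono C2) simp
      also have "\<dots> = 2 * C2 / R\<^sup>2 * ((\<bar>?b\<bar> * norm x) * (hyp_weight x ^ j * f x))"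
        by (simp add: mult_ac)
      also have "\<dots> \<le> 2 * C2 / R\<^sup>2 * ((C1 * R) * (hyp_weight x ^ j * f x))"
        using \<open>C2 \<ge> 0\<close> b fw by (intro mult_left_mono mult_right_mono) auto
      also have "\<dots> = 2 * C1 * C2 / R * (f x * hyp_weight x ^ j)"
        using that by (simp add: power2_eq_square field_simps)
      finally show "\<bar>wedge j (Suc l) (\<phi> x) (ext_deriv l \<omega> x) std_frame\<bar>
          \<le> 2 * C1 * C2 / R * (f x * hyp_weight x ^ j)" .
    qed
    finally show ?thesis
      by (simp add: I_def)
  qed
  \<comment> \<open>Large enough that c m R exceeds 2 C1 C2 I, against \<open>main\<close>; the
    summand 1 gives both R \<ge> 1 and strictness.\<close>
  define R where "R = 1 + \<bar>2 * C1 * C2 * I\<bar> / (c * m)"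
  have cm: "c * m > 0"
    using \<open>c > 0\<close> \<open>m > 0\<close> by simp
  then have "R \<ge> 1"
    by (simp add: R_def)
  have "c * m * R = c * m + \<bar>2 * C1 * C2 * I\<bar>"
    unfolding R_def distrib_left using \<open>c > 0\<close> \<open>m > 0\<close> by simp
  then have "c * m * R > 2 * C1 * C2 * I"
    using cm by linarith
  moreover have "c * m * R \<le> 2 * C1 * C2 / R * I * R"
    using main[OF \<open>R \<ge> 1\<close>] \<open>R \<ge> 1\<close> by (intro mult_right_mono) auto
  moreover have "2 * C1 * C2 / R * I * R = 2 * C1 * C2 * I"
    using \<open>R \<ge> 1\<close> by simp
  ultimately show False by simp
qed

section \<open>Membership of the constant form in \<open>L^p\<close>, and the conclusion\<close>

lemma loc_integrable_form_const:
  assumes "alternating k \<alpha>"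
  shows "loc_integrable_form k (\<lambda>x. \<alpha>)"
  unfolding loc_integrable_form_def set_integrable_def
  using assms borel_integrable_compact[OF _ continuous_on_const] by blast

lemma alternating_zero: "alternating k (\<lambda>v. 0)"
  by (auto simp: alternating_def intro: linearI)

lemma zero_in_Lp_forms: "(\<lambda>x v. 0) \<in> Lp_forms g p k"
  by (auto simp: Lp_forms_def loc_integrable_form_const alternating_zero alt_norm_def in_Lp_def)

lemma borel_measurable_alt_norm_hyperbolic:
  "(\<lambda>x :: real ^ 'n::finite. alt_norm (hyperbolic_metric x) k \<alpha>) \<in> borel_measurable borel"
proof -
  have [measurable]: "(\<lambda>x :: real ^ 'n. x $ i) \<in> borel_measurable borel" for i
    by (intro borel_measurable_continuous_onI continuous_intros)
  show ?thesis
    unfolding alt_norm_def matrix_inv_hyperbolic_metric radial_matrix_def sgn_div_norm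
    by (simp only: vec_lambda_beta vector_scaleR_component) measurable
qed

text \<open>As the norm is at most C w^(-j), its r-th power times the density is at most C^r w^(-e)
  with e = r j - (n - 1) > 0. For p = \<infinity> the second assumption on p is vacuous, and w \<ge>
  1 bounds the norm by C.\<close>

lemma bounded_form_in_Lp_forms:
  fixes \<alpha> :: "'n::finite alt" and p :: ereal
  assumes alt: "alternating (Suc j) \<alpha>"
    and bound: "\<And>v. (\<And>i. i < Suc j \<Longrightarrow> norm (v i) \<le> 1) \<Longrightarrow> \<bar>\<alpha> v\<bar> \<le> A"
    and p: "1 \<le> p" "\<And>r. p = ereal r \<Longrightarrow> real (CARD('n) - 1) < r * real j"
  shows "(\<lambda>x. \<alpha>) \<in> Lp_forms hyperbolic_metric p (Suc j)"
proof -
  define f where "f x = alt_norm (hyperbolic_metric x) (Suc j) \<alpha>" for x :: "real ^ 'n"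
  define C where "C = sqrt (real CARD('n) ^ Suc j) * ((1 + real (Suc j)) * A)"
  have "A \<ge> 0"
    using bound[of "\<lambda>_. 0"] by auto
  then have "C \<ge> 0"
    by (simp add: C_def)
  have f0: "f x \<ge> 0" for x
    by (simp add: f_def alt_norm_nonneg alternating_multilinear[OF alt])
  have fC: "f x \<le> C * (1 / hyp_weight x) ^ j" for x
    using alt_norm_bounded_form[OF alt _ bound, of x] by (simp add: f_def C_def del: power_Suc)
  have f_meas [measurable]: "f \<in> borel_measurable borel"
    unfolding f_def[abs_def] by (rule borel_measurable_alt_norm_hyperbolic)
  have "in_Lp (riem_volume hyperbolic_metric) p f"
  proof (cases p)
    case (real r)
    define e where "e = r * real j - real (CARD('n) - 1)"
    have "r \<ge> 1" "e > 0"
      using p(1) p(2)[OF real] real by (simp_all add: e_def)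
    have "integrable lborel (\<lambda>x. hyp_weight x ^ (CARD('n) - 1) * f x powr r)"
    proof (rule Bochner_Integration.integrable_bound)
      show "integrable lborel (\<lambda>x :: real ^ 'n. C powr r * hyp_weight x powr (- e))"
        by (intro integrable_mult_right integrable_hyp_weight_powr \<open>e > 0\<close>)
      show "AE x in lborel. norm (hyp_weight x ^ (CARD('n) - 1) * f x powr r)
          \<le> norm (C powr r * hyp_weight x powr (- e))"
      proof (rule AE_I2)
        fix x :: "real ^ 'n"
        let ?w = "hyp_weight x"
        have w: "?w > 0" by (rule hyp_weight_pos)
        have inv: "(1 / ?w) ^ j = ?w powr (- real j)"
          using w by (simp add: powr_minus powr_realpow power_one_over inverse_eq_divide)
        have "f x powr r \<le> (C * (1 / ?w) ^ j) powr r"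
          using f0 fC \<open>r \<ge> 1\<close> by (intro powr_mono2) auto
        also have "\<dots> = C powr r * ?w powr (- (r * real j))"
          unfolding inv using w \<open>C \<ge> 0\<close> by (simp add: powr_mult powr_powr mult.commute)
        finally have "?w ^ (CARD('n) - 1) * f x powr r
            \<le> ?w powr real (CARD('n) - 1) * (C powr r * ?w powr (- (r * real j)))"
          using w by (subst powr_realpow) (auto intro: mult_left_mono)
        also have "\<dots> = C powr r * (?w powr real (CARD('n) - 1) * ?w powr (- (r * real j)))"
          by (simp only: mult_ac)
        also have "\<dots> = C powr r * ?w powr (- e)"
          by (simp add: e_def flip: powr_add)
        finally show "norm (?w ^ (CARD('n) - 1) * f x powr r) \<le> norm (C powr r * ?w powr (- e))"
          using w by (simp add: abs_mult)
      qed
    qed simp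
    then show ?thesis
      using real f0 f_meas
      by (simp add: in_Lp_def integrable_riem_volume_hyperbolic cong: measurable_cong_sets)
  next
    case PInf
    have "\<bar>f x\<bar> \<le> C" for x
    proof -
      have "C * (1 / hyp_weight x) ^ j \<le> C * 1"
        using hyp_weight_ge_1[of x] \<open>C \<ge> 0\<close> by (intro mult_left_mono power_le_one) auto
      then show ?thesis
        using f0[of x] fC[of x] by simp
    qed
    then show ?thesis
      using PInf f_meas by (auto simp: in_Lp_def cong: measurable_cong_sets)
  qed (use p in simp)
  then show ?thesis
    using loc_integrable_form_const[OF alt] by (simp add: Lp_forms_def f_def[abs_def])
qed

theorem corollary7p4:
  fixes k :: nat and q p :: ereal
  assumes "CARD('n::finite) \<ge> 2"
    and "2 \<le> k" and "k \<le> CARD('n)"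
    and "1 \<le> q" and "1 \<le> p"
    and "q < ereal ((real CARD('n) - 1) / (real k - 1))"
    and "ereal ((real CARD('n) - 1) / (real k - 1)) < p"
  shows "Lqp_cohomology (hyperbolic_metric :: real ^ 'n \<Rightarrow> real ^ 'n ^ 'n) k q p
           \<noteq> {cohom_zero hyperbolic_metric k q p}"
proof
  let ?g = "hyperbolic_metric :: real ^ 'n \<Rightarrow> real ^ 'n ^ 'n"
  let ?\<theta> = "\<lambda>x :: real ^ 'n. head_form k :: 'n alt"
  assume trivial: "Lqp_cohomology ?g k q p = {cohom_zero ?g k q p}"
  obtain j where j: "k = Suc j" "j \<ge> 1"
    using assms(2) by (cases k) auto
  obtain l where l: "Suc j + l = CARD('n)"
    using assms(3) j le_Suc_ex by metis
  have n1: "real (CARD('n) - 1) = real CARD('n) - 1"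
    using assms(1) by simp
  obtain r where r: "q = ereal r"
    using assms(4,6) by (cases q) auto
  have "?\<theta> \<in> Lp_forms ?g p k"
    unfolding j(1)
  proof (rule bounded_form_in_Lp_forms)
    show "alternating (Suc j) (head_form (Suc j) :: 'n alt)"
      using l by (intro alternating_head_form) simp
    show "real (CARD('n) - 1) < s * real j" if "p = ereal s" for s
      using assms(7) j n1 that by (simp add: field_simps)
  qed (use assms abs_head_form_le in auto)
  then have Z: "?\<theta> \<in> Z_forms ?g k p"
    by (simp add: Z_forms_def weak_deriv_const)
  \<comment> \<open>The difference \<theta> - \<theta> is the weak differential of 0, so \<theta>
    lies in its own class.\<close>
  have "(\<lambda>x v. 0) \<in> B_forms ?g k q p"
    using zero_in_Lp_forms weak_deriv_const[of j "\<lambda>v. 0"] by (auto simp: B_forms_def j(1))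
  then have "(?\<theta>, ?\<theta>) \<in> cohom_rel ?g k q p"
    using Z by (simp add: cohom_rel_def)
  \<comment> \<open>The quotient has a single element, so the class of \<theta> is the zero
    class.\<close>
  moreover have "cohom_rel ?g k q p `` {?\<theta>} = cohom_zero ?g k q p"
    using quotientI[OF Z, of "cohom_rel ?g k q p"] trivial by (simp add: Lqp_cohomology_def)
  \<comment> \<open>Membership in the zero class concerns 0 - \<theta>, whence the minus sign in the
    form shown not to be exact.\<close>
  ultimately have "(\<lambda>x v. 0, ?\<theta>) \<in> cohom_rel ?g k q p"
    by (auto simp: cohom_zero_def)
  then obtain \<phi> where "\<phi> \<in> Lp_forms ?g q j" "weak_deriv j \<phi> (\<lambda>x v. - head_form (Suc j) v)"
    by (auto simp: cohom_rel_def B_forms_def j(1))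
  moreover have "1 \<le> r" "r * real j < real (CARD('n) - 1)"
    using assms(4,6) r j n1 by (auto simp: field_simps)
  ultimately show False
    using head_form_not_exact[OF l] r by blast
qed

end
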